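(* There exist a separable, complex uniformly convex (complex) Banach space $Y$, a bounded linear operator $B$ on $\mathcal{Y} := Y \oplus_\infty \mathbb{C}$, and a closed densely defined linear operator $A$ with a compact resolvent on $\mathcal{Y}$, such that the resolvent norms of $A$ and of $B$ are constant in a neighbourhood of $0$; that is, there is an open neighbourhood of $0$ in $\mathbb{C}$ contained in the resolvent sets of both $A$ and $B$ on which each of the functions $\lambda \mapsto \|(A-\lambda I)^{-1}\|$ and $\lambda \mapsto \|(B-\lambda I)^{-1}\|$ is constant.
   Context: A complex Banach space $Y$ is called complex uniformly convex if for every $\varepsilon > 0$ there exists $\delta > 0$ such that: whenever $x, y \in Y$, $\|y\| \ge \varepsilon$ and $\|x + \zeta y\| \le 1$ for all $\zeta \in \mathbb{C}$ with $|\zeta| \le 1$, then $\|x\| \le 1 - \delta$. $Y \oplus_\infty \mathbb{C}$ is the algebraic direct sum $Y \oplus \mathbb{C}$ with the norm $\|(y, z)\|_\infty = \max\{\|y\|_Y, |z|\}$. Resolvent norms are operator norms on this space. A closed densely defined operator on $\mathcal{Y}$ means a (possibly unbounded) closed linear operator with dense domain in $\mathcal{Y}$ and values in $\mathcal{Y}$. It has a compact resolvent if its resolvent set is nonempty and $(A-\lambda I)^{-1}$ is a compact operator for every (equivalently, for some) $\lambda$ in the resolvent set. *)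

theory Defs
  imports "HOL-Analysis.Analysis" "HOL-Library.Function_Algebras"
begin

class complex_vector_space = ab_group_add +
  fixes scaleC :: "complex \<Rightarrow> 'a \<Rightarrow> 'a"  (infixr \<open>*\<^sub>C\<close> 75)
  assumes scaleC_add_right: "a *\<^sub>C (x + y) = a *\<^sub>C x + a *\<^sub>C y"
    and scaleC_add_left: "(a + b) *\<^sub>C x = a *\<^sub>C x + b *\<^sub>C x"
    and scaleC_scaleC: "a *\<^sub>C (b *\<^sub>C x) = (a * b) *\<^sub>C x"
    and scaleC_one: "1 *\<^sub>C x = x"

interpretation cvec: vector_space "scaleC :: complex \<Rightarrow> 'a \<Rightarrow> 'a::complex_vector_space"
  by unfold_locales (fact scaleC_add_right scaleC_add_left scaleC_scaleC scaleC_one)+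

instantiation complex :: complex_vector_space
begin
definition scaleC_complex :: "complex \<Rightarrow> complex \<Rightarrow> complex"
  where "scaleC_complex c z = c * z"
instance
  by standard (simp_all add: scaleC_complex_def algebra_simps)
end

instantiation "fun" :: (type, complex_vector_space) complex_vector_space
begin
definition scaleC_fun :: "complex \<Rightarrow> ('a \<Rightarrow> 'b) \<Rightarrow> 'a \<Rightarrow> 'b"
  where "scaleC_fun c f = (\<lambda>x. c *\<^sub>C f x)"
instance
  by standard
    (simp_all add: scaleC_fun_def fun_eq_iff scaleC_add_right scaleC_add_left
      scaleC_scaleC scaleC_one)
end

instantiation prod :: (complex_vector_space, complex_vector_space) complex_vector_space
begin
definition scaleC_prod :: "complex \<Rightarrow> 'a \<times> 'b \<Rightarrow> 'a \<times> 'b"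
  where "scaleC_prod c p = (c *\<^sub>C fst p, c *\<^sub>C snd p)"
instance
  by standard
    (simp_all add: scaleC_prod_def prod_eq_iff scaleC_add_right scaleC_add_left
      scaleC_scaleC scaleC_one)
end

text \<open>
  A normed space is a pair \<open>(V, N)\<close> of a complex linear subspace \<open>V\<close> of an ambient complex vector
  space and a norm \<open>N\<close> on \<open>V\<close>. The ambient space contributes its linear structure only, and the
  values of \<open>N\<close> outside \<open>V\<close> play no role. This makes it possible to quantify existentially over
  Banach spaces. Every separable Banach space is linearly isometric to such a pair with
  \<open>V\<close> a subspace of the space \<open>nat \<Rightarrow> complex\<close> of all sequences: it has at most continuum many
  elements, and the space of all sequences has a Hamel basis of the cardinality of the continuum.
\<close>

definition complex_normed_space :: "'a::complex_vector_space set \<Rightarrow> ('a \<Rightarrow> real) \<Rightarrow> bool"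
  where "complex_normed_space V N \<longleftrightarrow>
    cvec.subspace V \<and>
    (\<forall>x\<in>V. 0 \<le> N x) \<and>
    (\<forall>x\<in>V. N x = 0 \<longleftrightarrow> x = 0) \<and>
    (\<forall>c. \<forall>x\<in>V. N (c *\<^sub>C x) = cmod c * N x) \<and>
    (\<forall>x\<in>V. \<forall>y\<in>V. N (x + y) \<le> N x + N y)"

lemma complex_normed_spaceD:
  assumes "complex_normed_space V N"
  shows "cvec.subspace V"
    and "x \<in> V \<Longrightarrow> 0 \<le> N x"
    and "x \<in> V \<Longrightarrow> N x = 0 \<longleftrightarrow> x = 0"
    and "x \<in> V \<Longrightarrow> N (c *\<^sub>C x) = cmod c * N x"
    and "x \<in> V \<Longrightarrow> y \<in> V \<Longrightarrow> N (x + y) \<le> N x + N y"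
  using assms by (simp_all add: complex_normed_space_def)

text \<open>
  The type of metrics demands nonnegativity and symmetry off the carrier too, hence the case
  distinction.
\<close>

definition norm_dist :: "'a::complex_vector_space set \<Rightarrow> ('a \<Rightarrow> real) \<Rightarrow> 'a \<Rightarrow> 'a \<Rightarrow> real"
  where "norm_dist V N x y = (if x \<in> V \<and> y \<in> V then N (x - y) else 0)"

definition norm_metric :: "'a::complex_vector_space set \<Rightarrow> ('a \<Rightarrow> real) \<Rightarrow> 'a metric"
  where "norm_metric V N = metric (V, norm_dist V N)"

abbreviation norm_topology :: "'a::complex_vector_space set \<Rightarrow> ('a \<Rightarrow> real) \<Rightarrow> 'a topology"
  where "norm_topology V N \<equiv> mtopology_of (norm_metric V N)"

lemma Metric_space_norm_dist:
  assumes "complex_normed_space V N"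
  shows "Metric_space V (norm_dist V N)"
proof -
  note V = complex_normed_spaceD[OF assms]
  have diff: "x - y \<in> V" if "x \<in> V" "y \<in> V" for x y
    using V(1) that by (rule cvec.subspace_diff)
  show ?thesis
  proof (rule Metric_space.intro)
    fix x y
    show "0 \<le> norm_dist V N x y"
      by (simp add: norm_dist_def V(2) diff)
    have "N (y - x) = N (x - y)" if "x \<in> V" "y \<in> V"
      using V(4)[of "x - y" "- 1"] that by (simp add: diff)
    then show "norm_dist V N x y = norm_dist V N y x"
      by (simp add: norm_dist_def)
  next
    fix x y assume "x \<in> V" "y \<in> V"
    then show "norm_dist V N x y = 0 \<longleftrightarrow> x = y"
      by (simp add: norm_dist_def V(3) diff)
  next
    fix x y z assume "x \<in> V" "y \<in> V" "z \<in> V"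
    then show "norm_dist V N x z \<le> norm_dist V N x y + norm_dist V N y z"
      using V(5)[of "x - y" "y - z"] by (simp add: norm_dist_def diff)
  qed
qed

lemma
  assumes "complex_normed_space V N"
  shows mspace_norm_metric: "mspace (norm_metric V N) = V"
    and mdist_norm_metric: "mdist (norm_metric V N) = norm_dist V N"
  using Metric_space_norm_dist[OF assms]
  by (simp_all add: norm_metric_def Metric_space.mspace_metric Metric_space.mdist_metric)

definition complex_banach_space :: "'a::complex_vector_space set \<Rightarrow> ('a \<Rightarrow> real) \<Rightarrow> bool"
  where "complex_banach_space V N \<longleftrightarrow>
    complex_normed_space V N \<and> mcomplete_of (norm_metric V N)"

definition complex_uniformly_convex :: "'a::complex_vector_space set \<Rightarrow> ('a \<Rightarrow> real) \<Rightarrow> bool"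
  where "complex_uniformly_convex V N \<longleftrightarrow>
    (\<forall>\<epsilon>>0. \<exists>\<delta>>0. \<forall>x\<in>V. \<forall>y\<in>V.
      N y \<ge> \<epsilon> \<and> (\<forall>\<zeta>. cmod \<zeta> \<le> 1 \<longrightarrow> N (x + \<zeta> *\<^sub>C y) \<le> 1) \<longrightarrow> N x \<le> 1 - \<delta>)"

definition max_norm :: "('a \<Rightarrow> real) \<Rightarrow> ('b \<Rightarrow> real) \<Rightarrow> 'a \<times> 'b \<Rightarrow> real"
  where "max_norm N M p = max (N (fst p)) (M (snd p))"

lemma complex_normed_space_max_norm:
  assumes "complex_normed_space V N" "complex_normed_space W M"
  shows "complex_normed_space (V \<times> W) (max_norm N M)"
proof -
  note N = complex_normed_spaceD[OF assms(1)] and M = complex_normed_spaceD[OF assms(2)]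
  have max0: "max a b = 0 \<longleftrightarrow> a = 0 \<and> b = 0" if "0 \<le> a" "0 \<le> b" for a b :: real
    using that by auto
  show ?thesis
    unfolding complex_normed_space_def
  proof (intro conjI ballI allI)
    show "cvec.subspace (V \<times> W)"
      using N(1) M(1) by (auto simp: cvec.subspace_def scaleC_prod_def zero_prod_def)
  next
    fix p assume p: "p \<in> V \<times> W"
    then show "0 \<le> max_norm N M p"
      using N(2)[of "fst p"] by (auto simp: max_norm_def)
    show "max_norm N M p = 0 \<longleftrightarrow> p = 0"
      using p by (auto simp: max_norm_def max0 N(2,3) M(2,3) zero_prod_def)
  next
    fix c p assume "p \<in> V \<times> W"
    then show "max_norm N M (c *\<^sub>C p) = cmod c * max_norm N M p"
      by (auto simp: max_norm_def scaleC_prod_def N(4) M(4) max_mult_distrib_left)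
  next
    fix p q assume "p \<in> V \<times> W" "q \<in> V \<times> W"
    then have "N (fst (p + q)) \<le> N (fst p) + N (fst q)" "M (snd (p + q)) \<le> M (snd p) + M (snd q)"
      using N(5) M(5) by auto
    moreover have "N (fst p) + N (fst q) \<le> max_norm N M p + max_norm N M q"
      "M (snd p) + M (snd q) \<le> max_norm N M p + max_norm N M q"
      unfolding max_norm_def by (intro add_mono max.cobounded1 max.cobounded2)+
    ultimately show "max_norm N M (p + q) \<le> max_norm N M p + max_norm N M q"
      unfolding max_norm_def[of N M "p + q"] by (intro max.boundedI) (erule (1) order_trans)+
  qed
qed

text \<open>
  A possibly unbounded operator in \<open>(V, N)\<close> is a pair of a domain \<open>D\<close> and a function \<open>A\<close>, of which
  only the restriction to \<open>D\<close> is relevant.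
\<close>

definition linear_operator :: "'a::complex_vector_space set \<Rightarrow> 'a set \<Rightarrow> ('a \<Rightarrow> 'a) \<Rightarrow> bool"
  where "linear_operator V D A \<longleftrightarrow>
    cvec.subspace D \<and> D \<subseteq> V \<and> A ` D \<subseteq> V \<and>
    (\<forall>x\<in>D. \<forall>y\<in>D. A (x + y) = A x + A y) \<and>
    (\<forall>c. \<forall>x\<in>D. A (c *\<^sub>C x) = c *\<^sub>C A x)"

definition bounded_operator ::
    "'a::complex_vector_space set \<Rightarrow> ('a \<Rightarrow> real) \<Rightarrow> ('a \<Rightarrow> 'a) \<Rightarrow> bool"
  where "bounded_operator V N T \<longleftrightarrow>
    linear_operator V V T \<and> (\<exists>C. \<forall>x\<in>V. N (T x) \<le> C * N x)"

definition closed_operator ::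
    "'a::complex_vector_space set \<Rightarrow> ('a \<Rightarrow> real) \<Rightarrow> 'a set \<Rightarrow> ('a \<Rightarrow> 'a) \<Rightarrow> bool"
  where "closed_operator V N D A \<longleftrightarrow>
    linear_operator V D A \<and>
    closedin (prod_topology (norm_topology V N) (norm_topology V N)) ((\<lambda>x. (x, A x)) ` D)"

definition densely_defined ::
    "'a::complex_vector_space set \<Rightarrow> ('a \<Rightarrow> real) \<Rightarrow> 'a set \<Rightarrow> bool"
  where "densely_defined V N D \<longleftrightarrow> norm_topology V N closure_of D = V"

definition compact_operator ::
    "'a::complex_vector_space set \<Rightarrow> ('a \<Rightarrow> real) \<Rightarrow> ('a \<Rightarrow> 'a) \<Rightarrow> bool"
  where "compact_operator V N T \<longleftrightarrow>
    linear_operator V V T \<and>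
    compactin (norm_topology V N) (norm_topology V N closure_of (T ` {x\<in>V. N x \<le> 1}))"

definition op_norm :: "'a::complex_vector_space set \<Rightarrow> ('a \<Rightarrow> real) \<Rightarrow> ('a \<Rightarrow> 'a) \<Rightarrow> real"
  where "op_norm V N T = (SUP x\<in>{x\<in>V. N x \<le> 1}. N (T x))"

definition resolvent :: "'a::complex_vector_space set \<Rightarrow> ('a \<Rightarrow> 'a) \<Rightarrow> complex \<Rightarrow> 'a \<Rightarrow> 'a"
  where "resolvent D A \<mu> = inv_into D (\<lambda>x. A x - \<mu> *\<^sub>C x)"

definition resolvent_set ::
    "'a::complex_vector_space set \<Rightarrow> ('a \<Rightarrow> real) \<Rightarrow> 'a set \<Rightarrow> ('a \<Rightarrow> 'a) \<Rightarrow> complex set"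
  where "resolvent_set V N D A =
    {\<mu>. bij_betw (\<lambda>x. A x - \<mu> *\<^sub>C x) D V \<and> bounded_operator V N (resolvent D A \<mu>)}"

definition compact_resolvent ::
    "'a::complex_vector_space set \<Rightarrow> ('a \<Rightarrow> real) \<Rightarrow> 'a set \<Rightarrow> ('a \<Rightarrow> 'a) \<Rightarrow> bool"
  where "compact_resolvent V N D A \<longleftrightarrow>
    resolvent_set V N D A \<noteq> {} \<and>
    (\<forall>\<mu>\<in>resolvent_set V N D A. compact_operator V N (resolvent D A \<mu>))"

end

theory Submission
  imports Defs
begin

text \<open>
  Take \<open>Y = \<ell>\<^sup>1\<close>. A holomorphic function with values in the dual \<open>\<ell>\<^sup>\<infinity>\<close> can have constant norm
  without being constant, such as \<open>\<mu> \<mapsto> (1, \<mu>, \<mu>\<^sup>2, \<dots>)\<close> on the unit disc, and the summand \<open>\<complex>\<close> turns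
  such functions into rows of a resolvent. Let \<open>R\<close> be a bilateral shift with weights in \<open>(0, 1]\<close>,
  with one weight replaced by \<open>4\<close>, namely that of the step from a basis vector \<open>e\<^sub>0\<close> of \<open>\<ell>\<^sup>1\<close> to the
  summand \<open>\<complex>\<close>. The inverse of \<open>R\<^sup>-\<^sup>1 - \<mu>\<close> sends \<open>x\<close> to the solution of \<open>p = R (x + \<mu> p)\<close>. The
  \<open>\<complex>\<close>-component of \<open>p\<close> is \<open>4\<close> times a functional whose coefficients are \<open>1\<close> at \<open>e\<^sub>0\<close> and products
  of weights and powers of \<open>\<mu>\<close> at the vectors before \<open>e\<^sub>0\<close>, so this row has norm exactly \<open>4\<close>, attained
  at \<open>e\<^sub>0\<close>. The \<open>\<ell>\<^sup>1\<close>-component does not exceed this for \<open>\<bar>\<mu>\<bar> < 1/4\<close>, as the weight \<open>4\<close> enters it only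
  with a factor \<open>\<mu>\<close>. Unit weights make \<open>R\<close> invertible and give \<open>B = R\<^sup>-\<^sup>1\<close>; summable weights make
  \<open>R\<close> compact with dense range and give \<open>A = R\<^sup>-\<^sup>1\<close>.
\<close>

section \<open>Operators with bounded inverse\<close>

lemma norm_topology_eq:
  assumes "complex_normed_space V N"
  shows "norm_topology V N = Metric_space.mtopology V (norm_dist V N)"
  using Metric_space_norm_dist[OF assms]
  by (simp add: mtopology_of_def mspace_norm_metric[OF assms] mdist_norm_metric[OF assms])

lemma topspace_norm_topology:
  assumes "complex_normed_space V N"
  shows "topspace (norm_topology V N) = V"
  using assms by (simp add: mspace_norm_metric)

lemma Hausdorff_space_norm_topology:
  assumes "complex_normed_space V N"
  shows "Hausdorff_space (norm_topology V N)"
  using Metric_space.Hausdorff_space_mtopology[OF Metric_space_norm_dist[OF assms]]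
  by (simp add: norm_topology_eq[OF assms])

lemma norm_minus_commute_on:
  assumes "complex_normed_space V N" "x \<in> V" "y \<in> V"
  shows "N (x - y) = N (y - x)"
  using Metric_space.commute[OF Metric_space_norm_dist[OF assms(1)], of x y] assms(2,3)
  by (simp add: norm_dist_def)

lemma limitin_norm_topology:
  assumes "complex_normed_space V N" "\<And>n. \<sigma> n \<in> V"
  shows "limitin (norm_topology V N) \<sigma> l sequentially \<longleftrightarrow>
    l \<in> V \<and> (\<lambda>n. N (\<sigma> n - l)) \<longlonglongrightarrow> 0"
proof -
  interpret Metric_space V "norm_dist V N" by (rule Metric_space_norm_dist[OF assms(1)])
  have "0 \<le> N (\<sigma> n - l)" if "l \<in> V" for n
    using complex_normed_spaceD(1,2)[OF assms(1)] assms(2) that cvec.subspace_diff by blast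
  then show ?thesis
    using assms(2)
    by (auto simp: norm_topology_eq[OF assms(1)] limit_metric_sequentially LIMSEQ_iff norm_dist_def)
qed

lemma in_closure_of_norm_topology:
  assumes "complex_normed_space V N" "S \<subseteq> V"
  shows "x \<in> norm_topology V N closure_of S \<longleftrightarrow> x \<in> V \<and> (\<forall>e>0. \<exists>s\<in>S. N (s - x) < e)"
proof -
  interpret Metric_space V "norm_dist V N" by (rule Metric_space_norm_dist[OF assms(1)])
  have "norm_dist V N x s = N (s - x)" if "x \<in> V" "s \<in> S" for s
    using that assms norm_minus_commute_on[OF assms(1)] by (auto simp: norm_dist_def)
  then show ?thesis
    using assms(2)
    by (fastforce simp: norm_topology_eq[OF assms(1)] metric_closure_of)
qed

lemma mcomplete_norm_metric:
  assumes "complex_normed_space V N"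
  shows "mcomplete_of (norm_metric V N) \<longleftrightarrow>
    (\<forall>\<sigma>. (\<forall>n. \<sigma> n \<in> V) \<longrightarrow> (\<forall>e>0. \<exists>K. \<forall>m\<ge>K. \<forall>n\<ge>K. N (\<sigma> m - \<sigma> n) < e) \<longrightarrow>
      (\<exists>l\<in>V. (\<lambda>n. N (\<sigma> n - l)) \<longlonglongrightarrow> 0))"
proof -
  interpret Metric_space V "norm_dist V N" by (rule Metric_space_norm_dist[OF assms])
  have cauchy: "MCauchy \<sigma> \<longleftrightarrow>
      (\<forall>n. \<sigma> n \<in> V) \<and> (\<forall>e>0. \<exists>K. \<forall>m\<ge>K. \<forall>n\<ge>K. N (\<sigma> m - \<sigma> n) < e)" for \<sigma>
    by (auto simp: MCauchy_def image_subset_iff norm_dist_def)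
  have lim: "(\<exists>l. limitin mtopology \<sigma> l sequentially) \<longleftrightarrow> (\<exists>l\<in>V. (\<lambda>n. N (\<sigma> n - l)) \<longlonglongrightarrow> 0)"
    if "\<forall>n. \<sigma> n \<in> V" for \<sigma>
    using limitin_norm_topology[OF assms, of \<sigma>] that by (auto simp: norm_topology_eq[OF assms])
  have "mcomplete_of (norm_metric V N) \<longleftrightarrow> mcomplete"
    by (simp add: mcomplete_of_def mspace_norm_metric[OF assms] mdist_norm_metric[OF assms])
  then show ?thesis
    by (simp add: mcomplete_def cauchy lim imp_conjL)
qed

lemma complex_banach_space_max_norm:
  assumes V: "complex_banach_space V N" and W: "complex_banach_space W M"
  shows "complex_banach_space (V \<times> W) (max_norm N M)"
proof -
  have NV: "complex_normed_space V N" and NW: "complex_normed_space W M"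
    using V W by (auto simp: complex_banach_space_def)
  note NVW = complex_normed_space_max_norm[OF NV NW]
  have "\<exists>l\<in>V \<times> W. (\<lambda>n. max_norm N M (\<sigma> n - l)) \<longlonglongrightarrow> 0"
    if \<sigma>: "\<forall>n. \<sigma> n \<in> V \<times> W"
      and C: "\<forall>e>0. \<exists>K. \<forall>m\<ge>K. \<forall>n\<ge>K. max_norm N M (\<sigma> m - \<sigma> n) < e" for \<sigma>
  proof -
    have "\<forall>n. fst (\<sigma> n) \<in> V" "\<forall>n. snd (\<sigma> n) \<in> W"
      using \<sigma> by (auto simp: mem_Times_iff)
    moreover have "\<exists>K. \<forall>m\<ge>K. \<forall>n\<ge>K. N (fst (\<sigma> m) - fst (\<sigma> n)) < e"
      "\<exists>K. \<forall>m\<ge>K. \<forall>n\<ge>K. M (snd (\<sigma> m) - snd (\<sigma> n)) < e" if "e > 0" for e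
      using C[rule_format, OF that] by (fastforce simp: max_norm_def)+
    ultimately obtain a b where "a \<in> V" "(\<lambda>n. N (fst (\<sigma> n) - a)) \<longlonglongrightarrow> 0"
      "b \<in> W" "(\<lambda>n. M (snd (\<sigma> n) - b)) \<longlonglongrightarrow> 0"
      using V[unfolded complex_banach_space_def mcomplete_norm_metric[OF NV],
          THEN conjunct2, rule_format, of "\<lambda>n. fst (\<sigma> n)"]
        W[unfolded complex_banach_space_def mcomplete_norm_metric[OF NW],
          THEN conjunct2, rule_format, of "\<lambda>n. snd (\<sigma> n)"]
      by auto
    then show ?thesis
      using tendsto_max[of "\<lambda>n. N (fst (\<sigma> n) - a)" 0 sequentially "\<lambda>n. M (snd (\<sigma> n) - b)" 0]
      by (intro bexI[of _ "(a, b)"]) (auto simp: max_norm_def)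
  qed
  then show ?thesis
    using NVW by (auto simp: complex_banach_space_def mcomplete_norm_metric)
qed

section \<open>Bounded operators and the closedness of their inverses\<close>

lemma linear_operator_add: "linear_operator V D T \<Longrightarrow> x \<in> D \<Longrightarrow> y \<in> D \<Longrightarrow> T (x + y) = T x + T y"
  and linear_operator_scale: "linear_operator V D T \<Longrightarrow> x \<in> D \<Longrightarrow> T (c *\<^sub>C x) = c *\<^sub>C T x"
  by (simp_all add: linear_operator_def)

lemma linear_operator_diff:
  assumes "linear_operator V D T" "x \<in> D" "y \<in> D"
  shows "T (x - y) = T x - T y"
proof -
  have D: "cvec.subspace D" using assms(1) by (simp add: linear_operator_def)
  have "T ((x - y) + y) = T (x - y) + T y"
    using assms cvec.subspace_diff[OF D] by (intro linear_operator_add[OF assms(1)])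
  then show ?thesis by (simp add: algebra_simps)
qed

lemma continuous_map_bounded_operator:
  assumes V: "complex_normed_space V N" and T: "bounded_operator V N T"
  shows "continuous_map (norm_topology V N) (norm_topology V N) T"
proof -
  obtain C where C: "\<And>x. x \<in> V \<Longrightarrow> N (T x) \<le> C * N x" and L: "linear_operator V V T"
    using T by (auto simp: bounded_operator_def)
  have "T \<in> V \<rightarrow> V" using L by (auto simp: linear_operator_def)
  moreover have "norm_dist V N (T x) (T y) \<le> C * norm_dist V N x y" if "x \<in> V" "y \<in> V" for x y
    using that \<open>T \<in> V \<rightarrow> V\<close> C[of "x - y"] cvec.subspace_diff[OF complex_normed_spaceD(1)[OF V]]
    by (auto simp: norm_dist_def linear_operator_diff[OF L])
  ultimately have "Lipschitz_continuous_map (norm_metric V N) (norm_metric V N) T"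
    by (auto simp: Lipschitz_continuous_map_def mspace_norm_metric[OF V] mdist_norm_metric[OF V])
  then show ?thesis by (rule Lipschitz_continuous_imp_continuous_map)
qed

text \<open>Unbounded operators arise here as inverses of everywhere defined injective ones. The
  left-inverse law alone makes \<open>R\<close> injective, and the range of \<open>R\<close> becomes
  the domain of \<open>A\<close>.\<close>

lemma linear_operator_inverse:
  assumes R: "linear_operator V V R" and A: "\<And>x. x \<in> V \<Longrightarrow> A (R x) = x"
  shows "linear_operator V (R ` V) A"
proof -
  have V: "cvec.subspace V" and im: "R ` V \<subseteq> V"
    and add: "\<And>x y. x \<in> V \<Longrightarrow> y \<in> V \<Longrightarrow> R x + R y = R (x + y)"
    and scale: "\<And>c x. x \<in> V \<Longrightarrow> c *\<^sub>C R x = R (c *\<^sub>C x)"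
    using R by (auto simp: linear_operator_def)
  note mem = cvec.subspace_add[OF V] cvec.subspace_scale[OF V] cvec.subspace_0[OF V]
  have "R 0 = 0" using scale[of 0 0] mem by simp
  then have "cvec.subspace (R ` V)"
    unfolding cvec.subspace_def using mem by (force simp: add scale)
  then show ?thesis
    using im by (auto simp: linear_operator_def add scale A mem)
qed

text \<open>The graph of \<open>A\<close> is the graph of \<open>R\<close> with its coordinates
  swapped, that is, the set where the continuous maps \<open>fst\<close> and \<open>R\<close> after
  \<open>snd\<close> agree. Such a set is closed because the target is Hausdorff.\<close>

lemma closed_operator_inverse:
  assumes V: "complex_normed_space V N" and R: "bounded_operator V N R"
    and A: "\<And>x. x \<in> V \<Longrightarrow> A (R x) = x"
  shows "closed_operator V N (R ` V) A"
proof -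
  let ?X = "norm_topology V N"
  have RV: "R ` V \<subseteq> V" and L: "linear_operator V V R"
    using R by (auto simp: bounded_operator_def linear_operator_def)
  have "(\<lambda>x. (x, A x)) ` R ` V = {p \<in> topspace (prod_topology ?X ?X). fst p = R (snd p)}"
    using RV A by (force simp: mspace_norm_metric[OF V] image_iff)
  moreover have "closedin (prod_topology ?X ?X) \<dots>"
    by (intro closedin_continuous_maps_eq[OF Hausdorff_space_norm_topology[OF V]]
        continuous_map_fst
        continuous_map_compose[OF continuous_map_snd continuous_map_bounded_operator[OF V R],
          unfolded o_def])
  ultimately show ?thesis
    using linear_operator_inverse[OF L A] by (simp add: closed_operator_def)
qed

section \<open>The resolvent of an inverse as a fixed point\<close>

text \<open>If p = R u, then (A - \<mu>) p = x says u = x + \<mu> p. The resolvent is thereby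
  described through the bounded operator \<open>R\<close> alone, and all later norm estimates start
  from this equation.\<close>

lemma resolvent_inverse_fixpoint:
  assumes V: "cvec.subspace V" and R: "linear_operator V V R"
    and A: "\<And>x. x \<in> V \<Longrightarrow> A (R x) = x"
    and \<mu>: "\<mu> \<in> resolvent_set V N (R ` V) A" and x: "x \<in> V"
  shows "resolvent (R ` V) A \<mu> x \<in> V"
    and "resolvent (R ` V) A \<mu> x = R (x + \<mu> *\<^sub>C resolvent (R ` V) A \<mu> x)"
proof -
  define p where "p = resolvent (R ` V) A \<mu> x"
  have bij: "bij_betw (\<lambda>x. A x - \<mu> *\<^sub>C x) (R ` V) V"
    using \<mu> by (simp add: resolvent_set_def)
  have p: "p \<in> R ` V"
    using x bij unfolding p_def resolvent_def by (metis bij_betw_imp_surj_on inv_into_into)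
  then have pV: "p \<in> V" using R by (auto simp: linear_operator_def)
  have eq: "A p - \<mu> *\<^sub>C p = x"
    unfolding p_def resolvent_def by (rule bij_betw_inv_into_right[OF bij x])
  obtain u where u: "u \<in> V" "p = R u" using p by auto
  then have "A p = u" using A by simp
  then have "u = x + \<mu> *\<^sub>C p" using eq by (simp add: algebra_simps)
  then show "resolvent (R ` V) A \<mu> x \<in> V"
    "resolvent (R ` V) A \<mu> x = R (x + \<mu> *\<^sub>C resolvent (R ` V) A \<mu> x)"
    using pV u(2) by (simp_all add: p_def)
qed

text \<open>The map sending p to R (x + \<mu> p) is Lipschitz with constant
  \<open>c * cmod \<mu>\<close> < 1, so Banach's fixed point theorem takes the place of a Neumann
  series.\<close>

lemma bounded_fixpoint:
  assumes "complex_banach_space V N" and R: "linear_operator V V R"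
    and bound: "\<And>x. x \<in> V \<Longrightarrow> N (R x) \<le> c * N x" and small: "c * cmod \<mu> < 1" and x: "x \<in> V"
  shows "\<exists>p\<in>V. p = R (x + \<mu> *\<^sub>C p)"
proof -
  have V: "complex_normed_space V N" and comp: "mcomplete_of (norm_metric V N)"
    using assms(1) by (auto simp: complex_banach_space_def)
  interpret Metric_space V "norm_dist V N" by (rule Metric_space_norm_dist[OF V])
  note VD = complex_normed_spaceD[OF V]
  note mem = cvec.subspace_add[OF VD(1)] cvec.subspace_scale[OF VD(1)] cvec.subspace_diff[OF VD(1)]
  have RV: "R v \<in> V" if "v \<in> V" for v using R that by (auto simp: linear_operator_def)
  have "norm_dist V N (R (x + \<mu> *\<^sub>C p)) (R (x + \<mu> *\<^sub>C q)) \<le> (c * cmod \<mu>) * norm_dist V N p q"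
    if "p \<in> V" "q \<in> V" for p q
  proof -
    have "R (x + \<mu> *\<^sub>C p) - R (x + \<mu> *\<^sub>C q) = R (\<mu> *\<^sub>C (p - q))"
      using that x mem
      by (simp add: linear_operator_diff[OF R, symmetric] cvec.scale_right_diff_distrib)
    then show ?thesis
      using bound[of "\<mu> *\<^sub>C (p - q)"] that x mem RV by (simp add: norm_dist_def VD(4))
  qed
  moreover have "mcomplete"
    using comp by (simp add: mcomplete_of_def mspace_norm_metric[OF V] mdist_norm_metric[OF V])
  ultimately obtain p where "p \<in> V" "R (x + \<mu> *\<^sub>C p) = p"
    using Banach_fixedpoint_thm[of "\<lambda>p. R (x + \<mu> *\<^sub>C p)" "c * cmod \<mu>"] small x RV mem
    by (auto simp: Pi_iff)
  then show ?thesis by metis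
qed

text \<open>Surjectivity of A - \<mu> comes from the fixed point. Injectivity and boundedness of the
  inverse both come from the a priori estimate \<open>est\<close>.\<close>

lemma resolvent_set_inverse:
  assumes B: "complex_banach_space V N" and R: "linear_operator V V R"
    and bound: "\<And>x. x \<in> V \<Longrightarrow> N (R x) \<le> c * N x" and A: "\<And>x. x \<in> V \<Longrightarrow> A (R x) = x"
    and small: "c * cmod \<mu> < 1" and c: "0 \<le> c"
  shows "\<mu> \<in> resolvent_set V N (R ` V) A"
proof -
  let ?D = "R ` V" and ?f = "\<lambda>x. A x - \<mu> *\<^sub>C x"
  have V: "complex_normed_space V N" using B by (auto simp: complex_banach_space_def)
  note VD = complex_normed_spaceD[OF V]
  note mem = cvec.subspace_add[OF VD(1)] cvec.subspace_scale[OF VD(1)] cvec.subspace_diff[OF VD(1)]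
  have LA: "linear_operator V ?D A" by (rule linear_operator_inverse[OF R A])
  have RV: "R v \<in> V" if "v \<in> V" for v using R that by (auto simp: linear_operator_def)
  have D: "cvec.subspace ?D" using LA by (simp add: linear_operator_def)
  note memD = cvec.subspace_add[OF D] cvec.subspace_scale[OF D] cvec.subspace_diff[OF D]
  \<comment> \<open>With p = R u one has N p <= c N u, and u = (A - \<mu>) p + \<mu> p. The term
    \<open>c * cmod \<mu> * N p\<close> is then absorbed on the left.\<close>
  have est: "N p \<le> c / (1 - c * cmod \<mu>) * N (?f p)" if p: "p \<in> ?D" for p
  proof -
    obtain u where u: "u \<in> V" "p = R u" using p by auto
    have "N u \<le> N (u - \<mu> *\<^sub>C p) + N (\<mu> *\<^sub>C p)"
      using VD(5)[of "u - \<mu> *\<^sub>C p" "\<mu> *\<^sub>C p"] u RV mem by simp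
    then have "N u \<le> N (?f p) + cmod \<mu> * N p"
      using u RV by (simp add: VD(4) A)
    then have "N p \<le> c * (N (?f p) + cmod \<mu> * N p)"
      using bound[OF u(1)] c unfolding u(2) by (meson mult_left_mono order_trans)
    then show ?thesis using small by (simp add: field_simps)
  qed
  have f_diff: "?f (p - q) = ?f p - ?f q" if "p \<in> ?D" "q \<in> ?D" for p q
    using that linear_operator_diff[OF LA] by (simp add: cvec.scale_right_diff_distrib)
  have inj: "inj_on ?f ?D"
  proof (rule inj_onI)
    fix p q assume *: "p \<in> ?D" "q \<in> ?D" "?f p = ?f q"
    have pq: "p - q \<in> V" using * RV mem(3) by auto
    have "N (p - q) \<le> c / (1 - c * cmod \<mu>) * N (?f (p - q))"
      using * memD(3) by (intro est)
    also have "?f (p - q) = 0" using * f_diff by simp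
    also have "N 0 = 0" using VD(3)[of 0] cvec.subspace_0[OF VD(1)] by simp
    finally have "N (p - q) = 0" using VD(2)[OF pq] by simp
    then show "p = q" using VD(3)[OF pq] by simp
  qed
  have surj: "?f ` ?D = V"
  proof
    show "?f ` ?D \<subseteq> V" using LA RV mem by (auto simp: A)
    show "V \<subseteq> ?f ` ?D"
    proof
      fix x assume x: "x \<in> V"
      obtain p where p: "p \<in> V" "p = R (x + \<mu> *\<^sub>C p)"
        using bounded_fixpoint[OF B R bound small x] by blast
      then have "A p = x + \<mu> *\<^sub>C p" using A mem x by metis
      moreover have "p \<in> ?D" using p x mem by blast
      ultimately show "x \<in> ?f ` ?D" by (force simp: image_iff)
    qed
  qed
  have bij: "bij_betw ?f ?D V" using inj surj by (simp add: bij_betw_def)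
  let ?S = "resolvent ?D A \<mu>"
  have S: "?S x \<in> ?D" "?f (?S x) = x" if "x \<in> V" for x
    unfolding resolvent_def using inv_into_into[of x ?f ?D] f_inv_into_f[of x ?f ?D] that
    by (simp_all only: surj)
  have DV: "?D \<subseteq> V" using LA by (simp add: linear_operator_def)
  have SV: "?S x \<in> V" if "x \<in> V" for x by (rule subsetD[OF DV S(1)[OF that]])
  have S_eq: "?S (?f p) = p" if "p \<in> ?D" for p
    unfolding resolvent_def by (rule inv_into_f_f[OF inj that])
  \<comment> \<open>Linearity passes to the inverse: apply the linear map \<open>?f\<close> to the
    candidate value and then invert it by \<open>S_eq\<close>.\<close>
  have S_add: "?S (x + y) = ?S x + ?S y" if "x \<in> V" "y \<in> V" for x y
  proof -
    have "A (?S x + ?S y) = A (?S x) + A (?S y)"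
      using that by (intro linear_operator_add[OF LA] S(1))
    then have "?f (?S x + ?S y) = ?f (?S x) + ?f (?S y)" by (simp add: scaleC_add_right)
    also have "\<dots> = x + y" using that by (simp only: S(2))
    finally show ?thesis using S_eq[of "?S x + ?S y"] memD(1) S(1) that by metis
  qed
  have S_scale: "?S (a *\<^sub>C x) = a *\<^sub>C ?S x" if "x \<in> V" for a x
  proof -
    have "A (a *\<^sub>C ?S x) = a *\<^sub>C A (?S x)"
      using that by (intro linear_operator_scale[OF LA] S(1))
    then have "?f (a *\<^sub>C ?S x) = a *\<^sub>C ?f (?S x)"
      by (simp add: scaleC_scaleC cvec.scale_right_diff_distrib mult.commute)
    also have "\<dots> = a *\<^sub>C x" using that by (simp only: S(2))
    finally show ?thesis using S_eq[of "a *\<^sub>C ?S x"] memD(2) S(1) that by metis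
  qed
  have "linear_operator V V ?S"
    unfolding linear_operator_def using VD(1) SV by (auto simp: S_add S_scale)
  moreover have "N (?S x) \<le> c / (1 - c * cmod \<mu>) * N x" if "x \<in> V" for x
    using est[OF S(1)[OF that]] by (simp only: S(2)[OF that])
  ultimately have "bounded_operator V N ?S" unfolding bounded_operator_def by blast
  then show ?thesis using bij by (simp add: resolvent_set_def)
qed

section \<open>Compact operators and compact resolvents\<close>

text \<open>\<open>T\<close> sends the unit ball into a ball of radius c, so the image under
  \<open>R\<close> lies in c times the compact closure for \<open>R\<close>. That multiple is
  compact as a continuous image.\<close>

lemma compact_operator_compose:
  assumes V: "complex_normed_space V N" and R: "compact_operator V N R"
    and T: "bounded_operator V N T"
  shows "compact_operator V N (\<lambda>x. R (T x))"
proof -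
  let ?X = "norm_topology V N" and ?ball = "{x \<in> V. N x \<le> 1}"
  note VD = complex_normed_spaceD[OF V]
  note mem = cvec.subspace_add[OF VD(1)] cvec.subspace_scale[OF VD(1)]
  have LR: "linear_operator V V R" and K: "compactin ?X (?X closure_of (R ` ?ball))"
    using R by (auto simp: compact_operator_def)
  obtain C where LT: "linear_operator V V T" and C: "\<And>x. x \<in> V \<Longrightarrow> N (T x) \<le> C * N x"
    using T by (auto simp: bounded_operator_def)
  \<comment> \<open>The bound \<open>C\<close> may be zero or negative; the maximum with 1 makes
    division by \<open>c\<close> possible.\<close>
  define c where "c = max C 1"
  have c: "c > 0" by (simp add: c_def)
  let ?K = "(\<lambda>x. of_real c *\<^sub>C x) ` (?X closure_of (R ` ?ball))"
  have "bounded_operator V N (\<lambda>x. of_real c *\<^sub>C x)"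
    unfolding bounded_operator_def linear_operator_def
    using VD(1) mem by (auto simp: VD(4) scaleC_add_right scaleC_scaleC mult.commute)
  then have K': "compactin ?X ?K"
    by (intro image_compactin[OF K] continuous_map_bounded_operator[OF V])
  have "R (T x) \<in> ?K" if x: "x \<in> ?ball" for x
  proof -
    have Tx: "T x \<in> V" using LT x by (auto simp: linear_operator_def)
    let ?u = "of_real (1 / c) *\<^sub>C T x"
    have "N (T x) \<le> c * N x"
      using x C[of x] VD(2)[of x] mult_right_mono[of C c "N x"] by (simp add: c_def)
    also have "\<dots> \<le> c" using x c by simp
    finally have "N (T x) / c \<le> 1" using c by simp
    then have u: "?u \<in> ?ball"
      using Tx mem(2)[OF Tx] c by (simp add: VD(4)[OF Tx] norm_divide)
    have "R (T x) = R (of_real c *\<^sub>C ?u)" using c by (simp add: scaleC_scaleC scaleC_one)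
    also have "\<dots> = of_real c *\<^sub>C R ?u" using LR u unfolding linear_operator_def by blast
    finally have "R (T x) = of_real c *\<^sub>C R ?u" .
    moreover have "R ` ?ball \<subseteq> topspace ?X"
      using LR by (auto simp: linear_operator_def mspace_norm_metric[OF V])
    then have "R ?u \<in> ?X closure_of (R ` ?ball)" using u closure_of_subset by blast
    ultimately show ?thesis by blast
  qed
  then have "?X closure_of ((\<lambda>x. R (T x)) ` ?ball) \<subseteq> ?K"
    using compactin_imp_closedin[OF Hausdorff_space_norm_topology[OF V] K']
    by (intro closure_of_minimal) auto
  then have "compactin ?X (?X closure_of ((\<lambda>x. R (T x)) ` ?ball))"
    using K' by (meson closed_compactin closedin_closure_of)
  moreover have "linear_operator V V (\<lambda>x. R (T x))"
    using LR LT unfolding linear_operator_def by (auto simp: image_subset_iff)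
  ultimately show ?thesis by (simp add: compact_operator_def)
qed

text \<open>Needed because the resolvent agrees with the composite in the resolvent identity only on
  \<open>V\<close>.\<close>

lemma compact_operator_cong:
  assumes "\<And>x. x \<in> V \<Longrightarrow> R x = T x"
  shows "compact_operator V N R \<longleftrightarrow> compact_operator V N T"
proof -
  have "R ` {x \<in> V. N x \<le> 1} = T ` {x \<in> V. N x \<le> 1}" using assms by (auto simp: image_iff)
  moreover have "linear_operator V V R \<longleftrightarrow> linear_operator V V T"
    unfolding linear_operator_def cvec.subspace_def using assms by (auto simp: image_subset_iff)
  ultimately show ?thesis by (simp add: compact_operator_def)
qed

text \<open>The resolvent identity \<open>(A - \<mu>)\<^sup>-\<^sup>1 = A\<^sup>-\<^sup>1 (I + \<mu> (A - \<mu>)\<^sup>-\<^sup>1)\<close> transfers compactness from \<open>A\<^sup>-\<^sup>1\<close>.\<close>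

lemma compact_resolvent_inverse:
  assumes V: "complex_normed_space V N" and R: "compact_operator V N R"
    and A: "\<And>x. x \<in> V \<Longrightarrow> A (R x) = x" and ne: "resolvent_set V N (R ` V) A \<noteq> {}"
  shows "compact_resolvent V N (R ` V) A"
proof -
  have LR: "linear_operator V V R" using R by (simp add: compact_operator_def)
  note VD = complex_normed_spaceD[OF V]
  note mem = cvec.subspace_add[OF VD(1)] cvec.subspace_scale[OF VD(1)]
  have "compact_operator V N (resolvent (R ` V) A \<mu>)" if \<mu>: "\<mu> \<in> resolvent_set V N (R ` V) A" for \<mu>
  proof -
    let ?S = "resolvent (R ` V) A \<mu>"
    obtain C where LS: "linear_operator V V ?S" and C: "\<And>x. x \<in> V \<Longrightarrow> N (?S x) \<le> C * N x"
      using \<mu> by (auto simp: resolvent_set_def bounded_operator_def)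
    have "linear_operator V V (\<lambda>x. x + \<mu> *\<^sub>C ?S x)"
      using LS mem
      by (auto simp: linear_operator_def image_subset_iff algebra_simps scaleC_add_right scaleC_scaleC)
    moreover have "N (x + \<mu> *\<^sub>C ?S x) \<le> (1 + cmod \<mu> * C) * N x" if x: "x \<in> V" for x
    proof -
      have S: "?S x \<in> V" using LS x by (auto simp: linear_operator_def)
      have "N (x + \<mu> *\<^sub>C ?S x) \<le> N x + cmod \<mu> * N (?S x)"
        using VD(5)[of x "\<mu> *\<^sub>C ?S x"] S x mem by (simp add: VD(4))
      also have "\<dots> \<le> N x + cmod \<mu> * (C * N x)"
        using C[OF x] by (intro add_left_mono mult_left_mono) auto
      finally show ?thesis by (simp add: algebra_simps)
    qed
    ultimately have "bounded_operator V N (\<lambda>x. x + \<mu> *\<^sub>C ?S x)"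
      unfolding bounded_operator_def by blast
    from compact_operator_compose[OF V R this] show ?thesis
      using resolvent_inverse_fixpoint(2)[OF VD(1) LR A \<mu>] by (subst compact_operator_cong) auto
  qed
  then show ?thesis using ne by (simp add: compact_resolvent_def)
qed

section \<open>The space of absolutely summable sequences\<close>

definition l1_space :: "(nat \<Rightarrow> complex) set"
  where "l1_space = {x. (\<lambda>i. cmod (x i)) summable_on UNIV}"

definition l1_norm :: "(nat \<Rightarrow> complex) \<Rightarrow> real"
  where "l1_norm x = (\<Sum>\<^sub>\<infinity>i. cmod (x i))"

lemma l1_space_iff: "x \<in> l1_space \<longleftrightarrow> (\<lambda>i. cmod (x i)) summable_on UNIV"
  by (simp add: l1_space_def)

text \<open>A uniform bound on finite partial sums gives membership and a norm bound at once, which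
  keeps infinite sums out of most later estimates.\<close>

lemma l1I:
  assumes "\<And>F. finite F \<Longrightarrow> (\<Sum>i\<in>F. cmod (x i)) \<le> b"
  shows "x \<in> l1_space" and "l1_norm x \<le> b"
proof -
  show "x \<in> l1_space"
    unfolding l1_space_iff using assms
    by (intro nonneg_bdd_above_summable_on bdd_aboveI[of _ b]) auto
  then show "l1_norm x \<le> b"
    unfolding l1_norm_def l1_space_iff by (rule infsum_le_finite_sums) (use assms in auto)
qed

lemma sum_le_l1_norm: "x \<in> l1_space \<Longrightarrow> finite F \<Longrightarrow> (\<Sum>i\<in>F. cmod (x i)) \<le> l1_norm x"
  unfolding l1_norm_def l1_space_iff by (rule finite_sum_le_infsum) auto

lemma l1_norm_nonneg: "0 \<le> l1_norm x"
  unfolding l1_norm_def by (rule infsum_nonneg) auto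

lemma cmod_le_l1_norm: "x \<in> l1_space \<Longrightarrow> cmod (x i) \<le> l1_norm x"
  using sum_le_l1_norm[of x "{i}"] by simp

lemma subspace_l1_space: "cvec.subspace l1_space"
proof (rule cvec.subspaceI)
  fix x y :: "nat \<Rightarrow> complex" and c
  assume x: "x \<in> l1_space"
  then show "c *\<^sub>C x \<in> l1_space"
    by (simp add: l1_space_iff scaleC_fun_def scaleC_complex_def norm_mult summable_on_cmult_right)
  assume y: "y \<in> l1_space"
  show "x + y \<in> l1_space"
    unfolding l1_space_iff
    by (rule summable_on_comparison_test[OF summable_on_add[OF x[unfolded l1_space_iff] y[unfolded l1_space_iff]]])
      (auto simp: norm_triangle_ineq)
qed (simp add: l1_space_iff)

lemma complex_normed_space_l1: "complex_normed_space l1_space l1_norm"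
  unfolding complex_normed_space_def
proof (intro conjI ballI allI)
  fix x assume x: "x \<in> l1_space"
  show "l1_norm x = 0 \<longleftrightarrow> x = 0"
  proof
    assume "l1_norm x = 0"
    then have "cmod (x i) \<le> 0" for i using cmod_le_l1_norm[OF x] by metis
    then show "x = 0" by (auto simp: fun_eq_iff)
  qed (simp add: l1_norm_def)
  show "l1_norm (c *\<^sub>C x) = cmod c * l1_norm x" for c
    by (simp add: l1_norm_def scaleC_fun_def scaleC_complex_def norm_mult infsum_cmult_right')
  fix y assume y: "y \<in> l1_space"
  have "l1_norm (x + y) \<le> (\<Sum>\<^sub>\<infinity>i. cmod (x i) + cmod (y i))"
    unfolding l1_norm_def
    using x y cvec.subspace_add[OF subspace_l1_space x y]
    by (intro infsum_mono) (auto simp: l1_space_iff norm_triangle_ineq intro: summable_on_add)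
  also have "\<dots> = l1_norm x + l1_norm y"
    unfolding l1_norm_def using x y by (intro infsum_add) (auto simp: l1_space_iff)
  finally show "l1_norm (x + y) \<le> l1_norm x + l1_norm y" .
qed (auto simp: subspace_l1_space l1_norm_nonneg)

lemmas l1_normed = complex_normed_spaceD[OF complex_normed_space_l1]
lemmas l1_diff = cvec.subspace_diff[OF subspace_l1_space]

lemma complex_banach_space_l1: "complex_banach_space l1_space l1_norm"
proof -
  have "\<exists>l\<in>l1_space. (\<lambda>n. l1_norm (\<sigma> n - l)) \<longlonglongrightarrow> 0"
    if \<sigma>: "\<forall>n. \<sigma> n \<in> l1_space"
      and C: "\<forall>e>0. \<exists>K. \<forall>m\<ge>K. \<forall>n\<ge>K. l1_norm (\<sigma> m - \<sigma> n) < e" for \<sigma>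
  proof -
    have mem: "\<sigma> m - \<sigma> n \<in> l1_space" for m n using \<sigma> l1_diff by blast
    have "Cauchy (\<lambda>n. \<sigma> n i)" for i
    proof (rule metric_CauchyI)
      fix e :: real assume "e > 0"
      then obtain K where "\<forall>m\<ge>K. \<forall>n\<ge>K. l1_norm (\<sigma> m - \<sigma> n) < e" using C by blast
      then have "dist (\<sigma> m i) (\<sigma> n i) < e" if "m \<ge> K" "n \<ge> K" for m n
        using cmod_le_l1_norm[OF mem, of m n i] that by (fastforce simp: dist_norm)
      then show "\<exists>K. \<forall>m\<ge>K. \<forall>n\<ge>K. dist (\<sigma> m i) (\<sigma> n i) < e" by blast
    qed
    then have "\<exists>l. \<forall>i. (\<lambda>n. \<sigma> n i) \<longlonglongrightarrow> l i"
      by (intro choice) (auto simp: Cauchy_convergent_iff convergent_def)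
    then obtain l where l: "\<And>i. (\<lambda>n. \<sigma> n i) \<longlonglongrightarrow> l i" by blast
    \<comment> \<open>The Cauchy bound holds for each finite partial sum; letting m tend to infinity
      there replaces \<sigma> m by the coordinatewise limit \<open>l\<close>, as in Fatou's lemma.
      Strict inequality is lost in the limit.\<close>
    have est: "\<sigma> n - l \<in> l1_space \<and> l1_norm (\<sigma> n - l) \<le> e"
      if K: "\<forall>m\<ge>K. \<forall>n\<ge>K. l1_norm (\<sigma> m - \<sigma> n) < e" and n: "n \<ge> K" for K n e
    proof -
      have "(\<Sum>i\<in>F. cmod ((\<sigma> n - l) i)) \<le> e" if F: "finite F" for F
      proof (rule tendsto_upperbound)
        show "(\<lambda>m. \<Sum>i\<in>F. cmod (\<sigma> n i - \<sigma> m i)) \<longlonglongrightarrow> (\<Sum>i\<in>F. cmod ((\<sigma> n - l) i))"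
          using l by (auto intro!: tendsto_intros)
        show "\<forall>\<^sub>F m in sequentially. (\<Sum>i\<in>F. cmod (\<sigma> n i - \<sigma> m i)) \<le> e"
          unfolding eventually_sequentially
        proof (intro exI[of _ K] allI impI)
          fix m assume "K \<le> m"
          then have "l1_norm (\<sigma> n - \<sigma> m) < e" using K n by blast
          then show "(\<Sum>i\<in>F. cmod (\<sigma> n i - \<sigma> m i)) \<le> e"
            using sum_le_l1_norm[OF mem F, of n m] by simp
        qed
      qed simp
      then show ?thesis using l1I by blast
    qed
    \<comment> \<open>Any tolerance serves here: one difference \<sigma> K1 - l in l1 already puts
      \<open>l\<close> itself into l1.\<close>
    obtain K1 where "\<forall>m\<ge>K1. \<forall>n\<ge>K1. l1_norm (\<sigma> m - \<sigma> n) < 1" using C zero_less_one by blast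
    then have "\<sigma> K1 - l \<in> l1_space" using est by blast
    then have "l \<in> l1_space" using l1_diff[of "\<sigma> K1" "\<sigma> K1 - l"] \<sigma> by simp
    moreover have "(\<lambda>n. l1_norm (\<sigma> n - l)) \<longlonglongrightarrow> 0"
    proof (rule LIMSEQ_I)
      fix e :: real assume e: "e > 0"
      then obtain K where "\<forall>m\<ge>K. \<forall>n\<ge>K. l1_norm (\<sigma> m - \<sigma> n) < e / 2"
        using C half_gt_zero by blast
      then have "l1_norm (\<sigma> n - l) < e" if "n \<ge> K" for n
        using est[of K "e / 2" n] that e by force
      then show "\<exists>K. \<forall>n\<ge>K. norm (l1_norm (\<sigma> n - l) - 0) < e"
        by (auto simp: l1_norm_nonneg)
    qed
    ultimately show ?thesis by blast
  qed
  then show ?thesis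
    by (simp add: complex_banach_space_def complex_normed_space_l1
        mcomplete_norm_metric[OF complex_normed_space_l1])
qed

section \<open>Dominated convergence, truncation and separability\<close>

text \<open>Dominated convergence for series: a finite set \<open>F\<close> carries all but e/3 of
  the sum of \<open>g\<close>. Outside \<open>F\<close> the differences are bounded by that tail,
  and on \<open>F\<close> finitely many coordinates converge.\<close>

lemma l1_tendsto_dominated:
  assumes g: "g summable_on UNIV" and dom: "\<And>n i. cmod (f n i - l i) \<le> g i"
    and lim: "\<And>i. (\<lambda>n. f n i) \<longlonglongrightarrow> l i"
  shows "(\<lambda>n. l1_norm (f n - l)) \<longlonglongrightarrow> 0"
proof (rule LIMSEQ_I)
  fix e :: real assume e: "e > 0"
  have g0: "0 \<le> g i" for i using dom[of 0 i] norm_ge_zero order_trans by blast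
  obtain F where F: "finite F" "dist (sum g F) (infsum g UNIV) \<le> e / 3"
    using infsum_finite_approximation[OF g, of "e / 3"] e by auto
  have "(\<lambda>n. \<Sum>i\<in>F. cmod (f n i - l i)) \<longlonglongrightarrow> (\<Sum>i\<in>F. cmod (l i - l i))"
    using lim by (intro tendsto_intros)
  then have "\<forall>\<^sub>F n in sequentially. (\<Sum>i\<in>F. cmod (f n i - l i)) < e / 3"
    using e by (intro order_tendstoD(2)) auto
  then obtain K where K: "\<And>n. n \<ge> K \<Longrightarrow> (\<Sum>i\<in>F. cmod (f n i - l i)) < e / 3"
    by (auto simp: eventually_sequentially)
  have "l1_norm (f n - l) \<le> e / 3 + e / 3" if n: "n \<ge> K" for n
  proof (rule l1I(2))
    fix G :: "nat set" assume G: "finite G"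
    have "(\<Sum>i\<in>G. cmod ((f n - l) i)) \<le> (\<Sum>i\<in>F \<union> (G - F). cmod (f n i - l i))"
      using F G by (auto intro!: sum_mono2)
    also have "\<dots> = (\<Sum>i\<in>F. cmod (f n i - l i)) + (\<Sum>i\<in>G - F. cmod (f n i - l i))"
      using F G by (intro sum.union_disjoint) auto
    also have "(\<Sum>i\<in>G - F. cmod (f n i - l i)) \<le> sum g (G - F)"
      by (intro sum_mono dom)
    also have "sum g (G - F) = sum g (F \<union> (G - F)) - sum g F"
      using F G by (subst sum.union_disjoint) auto
    also have "sum g (F \<union> (G - F)) \<le> infsum g UNIV"
      using F G by (intro finite_sum_le_infsum g) (auto simp: g0)
    finally show "(\<Sum>i\<in>G. cmod ((f n - l) i)) \<le> e / 3 + e / 3"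
      using K[OF n] F(2) unfolding dist_real_def by linarith
  qed
  then show "\<exists>K. \<forall>n\<ge>K. norm (l1_norm (f n - l) - 0) < e"
    using e by (intro exI[of _ K]) (force simp: l1_norm_nonneg)
qed

definition truncate :: "nat \<Rightarrow> (nat \<Rightarrow> complex) \<Rightarrow> nat \<Rightarrow> complex"
  where "truncate n x = (\<lambda>i. if i < n then x i else 0)"

lemma truncate_in_l1: "truncate n x \<in> l1_space"
proof -
  have "(\<lambda>i. cmod (truncate n x i)) summable_on {..<n}" by simp
  then show ?thesis
    unfolding l1_space_iff by (rule summable_on_cong_neutral[THEN iffD1, rotated -1]) (auto simp: truncate_def)
qed

lemma truncate_tendsto:
  assumes "x \<in> l1_space"
  shows "(\<lambda>n. l1_norm (truncate n x - x)) \<longlonglongrightarrow> 0"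
proof (rule l1_tendsto_dominated)
  show "(\<lambda>i. cmod (x i)) summable_on UNIV" using assms by (simp add: l1_space_iff)
  show "cmod (truncate n x i - x i) \<le> cmod (x i)" for n i by (simp add: truncate_def)
  show "(\<lambda>n. truncate n x i) \<longlonglongrightarrow> x i" for i
    by (rule tendsto_eventually) (auto simp: truncate_def eventually_sequentially intro!: exI[of _ "Suc i"])
qed

lemma separable_space_l1: "separable_space (norm_topology l1_space l1_norm)"
proof -
  obtain Q :: "complex set" where Q: "countable Q"
    and dense: "\<And>X. open X \<Longrightarrow> X \<noteq> {} \<Longrightarrow> \<exists>d\<in>Q. d \<in> X"
    using countable_dense_setE by metis
  \<comment> \<open>Finite lists over the countable dense set \<open>Q\<close>, continued by zeros,
    form the countable dense subset.\<close>
  define h :: "complex list \<Rightarrow> nat \<Rightarrow> complex"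
    where "h l = truncate (length l) (\<lambda>i. l ! i)" for l
  define C where "C = h ` lists Q"
  have "countable C" using Q by (simp add: C_def)
  moreover have CV: "C \<subseteq> l1_space" by (auto simp: C_def h_def truncate_in_l1)
  moreover have "norm_topology l1_space l1_norm closure_of C = l1_space"
  proof -
    have "\<exists>s\<in>C. l1_norm (s - x) < e" if x: "x \<in> l1_space" and e: "e > 0" for x e
    proof -
      obtain n where n: "l1_norm (truncate n x - x) < e / 2"
        using order_tendstoD(2)[OF truncate_tendsto[OF x], of "e / 2"] e
        by (auto simp: eventually_sequentially)
      \<comment> \<open>At most \<open>n\<close> coordinates each contribute an error
        \<open>r\<close>, so the total stays within e/2. The added 1 keeps \<open>r\<close> positive
        when \<open>n\<close> is 0.\<close>
      define r where "r = e / 2 / (real n + 1)"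
      have r: "r > 0" using e by (simp add: r_def)
      have "\<exists>q\<in>Q. q \<in> ball (x i) r" for i using dense[of "ball (x i) r"] r by auto
      then obtain q where q: "\<And>i. q i \<in> Q" "\<And>i. cmod (q i - x i) < r"
        by (metis dist_norm mem_ball norm_minus_commute)
      let ?s = "h (map q [0..<n])"
      have s: "?s = truncate n q" by (auto simp: h_def truncate_def fun_eq_iff)
      have "?s \<in> C"
        unfolding C_def using q(1) by (intro imageI) (auto simp: in_lists_conv_set)
      have "l1_norm (?s - truncate n x) \<le> e / 2"
      proof (rule l1I(2))
        fix F :: "nat set" assume F: "finite F"
        have "(\<Sum>i\<in>F. cmod ((?s - truncate n x) i)) \<le> (\<Sum>i\<in>F. if i < n then r else 0)"
          using q(2) by (intro sum_mono) (auto simp: s truncate_def less_imp_le)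
        also have "\<dots> = (\<Sum>i\<in>F \<inter> {..<n}. r)" using F by (simp add: sum.If_cases Int_def lessThan_def)
        also have "\<dots> \<le> real n * r"
          using r card_mono[of "{..<n}" "F \<inter> {..<n}"] by (simp add: mult_right_mono)
        also have "\<dots> \<le> e / 2" using e by (simp add: r_def field_simps)
        finally show "(\<Sum>i\<in>F. cmod ((?s - truncate n x) i)) \<le> e / 2" .
      qed
      moreover have "l1_norm (?s - x) \<le> l1_norm (?s - truncate n x) + l1_norm (truncate n x - x)"
        using l1_normed(5)[of "?s - truncate n x" "truncate n x - x"] x
        by (simp add: s l1_diff truncate_in_l1)
      ultimately have "l1_norm (?s - x) < e" using n by linarith
      then show ?thesis using \<open>?s \<in> C\<close> by blast
    qed
    then show ?thesis
      using in_closure_of_norm_topology[OF complex_normed_space_l1 CV] by blast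
  qed
  ultimately show ?thesis
    using topspace_norm_topology[OF complex_normed_space_l1]
    by (auto simp: separable_space_def)
qed

section \<open>Complex uniform convexity\<close>

text \<open>A quantitative form of the subharmonicity of the modulus. With P and Q the sums over the
  opposite pairs +b, -b and +ib, -ib, the parallelogram law gives P^2 + Q^2 >= 8|a|^2 + 4|b|^2,
  because a^2 - b^2 and a^2 + b^2 add up to 2a^2. Together with PQ >= 4|a|^2 this bounds (P + Q)^2
  below by 16|a|^2 + 4|b|^2.\<close>

lemma cmod_four_point_average:
  fixes a b :: complex
  shows "sqrt ((cmod a)\<^sup>2 + (cmod b / 2)\<^sup>2) \<le>
    (cmod (a + b) + cmod (a - b) + cmod (a + \<i> * b) + cmod (a - \<i> * b)) / 4"
proof -
  have parallelogram: "(cmod (a + z) + cmod (a - z))\<^sup>2 =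
      2 * (cmod a)\<^sup>2 + 2 * (cmod z)\<^sup>2 + 2 * cmod (a\<^sup>2 - z\<^sup>2)" for z
  proof -
    have "(cmod (a + z))\<^sup>2 + (cmod (a - z))\<^sup>2 = 2 * (cmod a)\<^sup>2 + 2 * (cmod z)\<^sup>2"
      unfolding cmod_power2 by (simp add: power2_eq_square algebra_simps)
    moreover have "cmod (a + z) * cmod (a - z) = cmod (a\<^sup>2 - z\<^sup>2)"
      by (simp add: norm_mult[symmetric] power2_eq_square algebra_simps)
    ultimately show ?thesis by (simp add: power2_sum)
  qed
  have ge: "2 * cmod a \<le> cmod (a + z) + cmod (a - z)" for z
    using norm_triangle_ineq[of "a + z" "a - z"] by (simp add: norm_mult flip: mult_2)
  define P Q where "P = cmod (a + b) + cmod (a - b)" and "Q = cmod (a + \<i> * b) + cmod (a - \<i> * b)"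
  have "2 * (cmod a)\<^sup>2 = cmod ((a\<^sup>2 - b\<^sup>2) + (a\<^sup>2 + b\<^sup>2))"
    by (simp add: norm_mult norm_power flip: mult_2)
  also have "\<dots> \<le> cmod (a\<^sup>2 - b\<^sup>2) + cmod (a\<^sup>2 + b\<^sup>2)" by (rule norm_triangle_ineq)
  finally have "8 * (cmod a)\<^sup>2 + 4 * (cmod b)\<^sup>2 \<le> P\<^sup>2 + Q\<^sup>2"
    using parallelogram[of b] parallelogram[of "\<i> * b"]
    by (simp add: P_def Q_def norm_mult power_mult_distrib)
  moreover have "4 * (cmod a)\<^sup>2 \<le> P * Q"
    using mult_mono[OF ge[of b] ge[of "\<i> * b"]]
    by (simp add: P_def Q_def power2_eq_square)
  ultimately have "(cmod a)\<^sup>2 + (cmod b / 2)\<^sup>2 \<le> ((P + Q) / 4)\<^sup>2"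
    by (simp add: power2_sum power_divide)
  then have "sqrt ((cmod a)\<^sup>2 + (cmod b / 2)\<^sup>2) \<le> (P + Q) / 4"
    by (rule real_le_lsqrt[rotated -1]) (auto simp: P_def Q_def)
  then show ?thesis by (simp add: P_def Q_def)
qed

lemma l1_four_point_average:
  assumes x: "x \<in> l1_space" and y: "y \<in> l1_space"
  shows "sqrt ((l1_norm x)\<^sup>2 + (l1_norm y / 2)\<^sup>2) \<le>
    (l1_norm (x + y) + l1_norm (x - y) + l1_norm (x + \<i> *\<^sub>C y) + l1_norm (x - \<i> *\<^sub>C y)) / 4"
proof -
  \<comment> \<open>Packing both moduli into one complex number turns the required Minkowski
    inequality into the triangle inequality for an infinite sum of complex numbers.\<close>
  define f where "f i = Complex (cmod (x i)) (cmod (y i) / 2)" for i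
  define g where "g i = (cmod ((x + y) i) + cmod ((x - y) i) + cmod ((x + \<i> *\<^sub>C y) i)
    + cmod ((x - \<i> *\<^sub>C y) i)) / 4" for i
  note mem = cvec.subspace_add[OF subspace_l1_space] cvec.subspace_scale[OF subspace_l1_space] l1_diff
  have iy: "\<i> *\<^sub>C y \<in> l1_space" using y mem by blast
  have S: "(\<lambda>i. cmod (x i)) summable_on UNIV" "(\<lambda>i. cmod (y i)) summable_on UNIV"
    "(\<lambda>i. cmod ((x + y) i)) summable_on UNIV" "(\<lambda>i. cmod ((x - y) i)) summable_on UNIV"
    "(\<lambda>i. cmod ((x + \<i> *\<^sub>C y) i)) summable_on UNIV" "(\<lambda>i. cmod ((x - \<i> *\<^sub>C y) i)) summable_on UNIV"
    using mem x y iy unfolding l1_space_iff[symmetric] by blast+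
  have g: "(g has_sum (l1_norm (x + y) + l1_norm (x - y) + l1_norm (x + \<i> *\<^sub>C y)
      + l1_norm (x - \<i> *\<^sub>C y)) / 4) UNIV"
    unfolding g_def l1_norm_def divide_inverse
    by (intro has_sum_cmult_left has_sum_add has_sum_infsum S)
  have fg: "cmod (f i) \<le> g i" for i
    using cmod_four_point_average[of "x i" "y i"]
    by (simp add: f_def g_def complex_norm scaleC_fun_def scaleC_complex_def)
  have f: "(\<lambda>i. cmod (f i)) summable_on UNIV"
    by (rule summable_on_comparison_test[OF has_sum_imp_summable[OF g]]) (auto simp: fg)
  have "((\<lambda>i. complex_of_real (cmod (x i)) + \<i> * complex_of_real (cmod (y i) * (1 / 2)))
      has_sum (complex_of_real (l1_norm x) + \<i> * complex_of_real (l1_norm y * (1 / 2)))) UNIV"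
    unfolding l1_norm_def
    by (intro has_sum_add has_sum_cmult_right has_sum_of_real has_sum_cmult_left has_sum_infsum S)
  then have "(f has_sum Complex (l1_norm x) (l1_norm y / 2)) UNIV"
    by (simp add: f_def[abs_def] Complex_eq)
  then have "cmod (Complex (l1_norm x) (l1_norm y / 2)) \<le> (\<Sum>\<^sub>\<infinity>i. cmod (f i))"
    using norm_infsum_bound[OF f] by (simp add: infsumI)
  also have "\<dots> \<le> infsum g UNIV"
    by (rule infsum_mono[OF f has_sum_imp_summable[OF g] fg])
  finally show ?thesis using infsumI[OF g] by (simp add: complex_norm)
qed

text \<open>Testing \<zeta> = 1, -1, i, -i bounds the four-point mean by 1, hence
  \<open>l1_norm x\<close> squared by 1 - e^2/4, which is at most (1 - e^2/8)^2. This is the source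
  of the modulus e^2/8.\<close>

lemma complex_uniformly_convex_l1: "complex_uniformly_convex l1_space l1_norm"
  unfolding complex_uniformly_convex_def
proof (intro allI impI)
  fix e :: real assume e: "e > 0"
  show "\<exists>\<delta>>0. \<forall>x\<in>l1_space. \<forall>y\<in>l1_space.
      e \<le> l1_norm y \<and> (\<forall>\<zeta>. cmod \<zeta> \<le> 1 \<longrightarrow> l1_norm (x + \<zeta> *\<^sub>C y) \<le> 1) \<longrightarrow> l1_norm x \<le> 1 - \<delta>"
  proof (intro exI[of _ "e\<^sup>2 / 8"] conjI ballI impI)
    show "0 < e\<^sup>2 / 8" using e by simp
    fix x y assume x: "x \<in> l1_space" and y: "y \<in> l1_space"
      and H: "e \<le> l1_norm y \<and> (\<forall>\<zeta>. cmod \<zeta> \<le> 1 \<longrightarrow> l1_norm (x + \<zeta> *\<^sub>C y) \<le> 1)"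
    have "l1_norm (x + 1 *\<^sub>C y) \<le> 1" "l1_norm (x + (- 1) *\<^sub>C y) \<le> 1"
      "l1_norm (x + \<i> *\<^sub>C y) \<le> 1" "l1_norm (x + (- \<i>) *\<^sub>C y) \<le> 1"
      using H by (metis norm_one order_refl, metis norm_one norm_minus_cancel order_refl,
          metis norm_ii order_refl, metis norm_ii norm_minus_cancel order_refl)
    then have "l1_norm (x + y) \<le> 1" "l1_norm (x - y) \<le> 1"
      "l1_norm (x + \<i> *\<^sub>C y) \<le> 1" "l1_norm (x - \<i> *\<^sub>C y) \<le> 1"
      by (simp_all add: scaleC_one)
    then have "sqrt ((l1_norm x)\<^sup>2 + (l1_norm y / 2)\<^sup>2) \<le> 1"
      by (intro order_trans[OF l1_four_point_average[OF x y]]) simp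
    then have "(l1_norm x)\<^sup>2 + (l1_norm y / 2)\<^sup>2 \<le> 1" by simp
    moreover have "(e / 2)\<^sup>2 \<le> (l1_norm y / 2)\<^sup>2" using H e by (intro power_mono) auto
    ultimately have le: "(l1_norm x)\<^sup>2 \<le> 1 - e\<^sup>2 / 4" by (simp add: power_divide)
    also have "\<dots> \<le> (1 - e\<^sup>2 / 8)\<^sup>2" by (simp add: power2_diff)
    \<comment> \<open>Taking roots requires 1 - e^2/8 >= 0, which follows from 0 <= 1 -
      e^2/4.\<close>
    finally show "l1_norm x \<le> 1 - e\<^sup>2 / 8"
      by (rule power2_le_imp_le) (use le zero_le_power2[of "l1_norm x"] in linarith)
  qed
qed

section \<open>The bilateral shift\<close>

definition l1_inf :: "((nat \<Rightarrow> complex) \<times> complex) set"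
  where "l1_inf = l1_space \<times> UNIV"

definition l1_inf_norm :: "(nat \<Rightarrow> complex) \<times> complex \<Rightarrow> real"
  where "l1_inf_norm = max_norm l1_norm cmod"

lemma l1_inf_iff: "p \<in> l1_inf \<longleftrightarrow> fst p \<in> l1_space"
  by (auto simp: l1_inf_def mem_Times_iff)

lemma l1_inf_norm_le_iff: "l1_inf_norm p \<le> c \<longleftrightarrow> l1_norm (fst p) \<le> c \<and> cmod (snd p) \<le> c"
  by (simp add: l1_inf_norm_def max_norm_def)

lemma l1_norm_fst_le: "l1_norm (fst p) \<le> l1_inf_norm p"
  and cmod_snd_le: "cmod (snd p) \<le> l1_inf_norm p"
  by (simp_all add: l1_inf_norm_def max_norm_def)

lemma complex_banach_space_complex: "complex_banach_space UNIV cmod"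
proof -
  have N: "complex_normed_space (UNIV :: complex set) cmod"
    by (simp add: complex_normed_space_def scaleC_complex_def norm_mult norm_triangle_ineq)
  have "\<exists>l. (\<lambda>n. cmod (\<sigma> n - l)) \<longlonglongrightarrow> 0"
    if "\<forall>e>0. \<exists>K. \<forall>m\<ge>K. \<forall>n\<ge>K. cmod (\<sigma> m - \<sigma> n) < e" for \<sigma>
  proof -
    have "Cauchy \<sigma>" using that by (simp add: Cauchy_def dist_norm)
    then obtain l where "\<sigma> \<longlonglongrightarrow> l" by (auto simp: Cauchy_convergent_iff convergent_def)
    then show ?thesis by (auto simp: tendsto_dist_iff[of \<sigma>] dist_norm)
  qed
  then show ?thesis by (simp add: complex_banach_space_def N mcomplete_norm_metric[OF N])
qed

lemma complex_banach_space_l1_inf: "complex_banach_space l1_inf l1_inf_norm"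
  unfolding l1_inf_def l1_inf_norm_def
  by (rule complex_banach_space_max_norm[OF complex_banach_space_l1 complex_banach_space_complex])

lemma complex_normed_space_l1_inf: "complex_normed_space l1_inf l1_inf_norm"
  using complex_banach_space_l1_inf by (simp add: complex_banach_space_def)

lemmas l1_inf_normed = complex_normed_spaceD[OF complex_normed_space_l1_inf]

text \<open>By Tychonoff the box is compact for coordinatewise convergence, so every sequence has a
  coordinatewise convergent subsequence. Differences are dominated by the summable 2g, so dominated
  convergence upgrades this to convergence in norm.\<close>

lemma compactin_l1_inf_box:
  assumes g: "g summable_on UNIV"
  shows "compactin (norm_topology l1_inf l1_inf_norm)
    {p. (\<forall>i. cmod (fst p i) \<le> g i) \<and> cmod (snd p) \<le> c}" (is "compactin _ ?K")
proof -
  interpret Metric_space l1_inf "norm_dist l1_inf l1_inf_norm"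
    by (rule Metric_space_norm_dist[OF complex_normed_space_l1_inf])
  have "compactin (product_topology (\<lambda>i. euclidean) UNIV) (PiE UNIV (\<lambda>i. cball (0::complex) (g i)))"
    by (simp add: compactin_PiE)
  then have "compact (PiE UNIV (\<lambda>i. cball (0::complex) (g i)))"
    by (simp add: euclidean_product_topology)
  then have "compact (PiE UNIV (\<lambda>i. cball (0::complex) (g i)) \<times> cball (0::complex) c)"
    by (intro compact_Times) auto
  moreover have "PiE UNIV (\<lambda>i. cball (0::complex) (g i)) \<times> cball (0::complex) c = ?K"
    by (auto simp: PiE_iff)
  ultimately have "seq_compact ?K" by (simp add: compact_imp_seq_compact)
  have sub: "?K \<subseteq> l1_inf"
    unfolding l1_inf_iff[abs_def] l1_space_iff subset_iff
    by (auto intro: summable_on_comparison_test[OF g])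
  have "\<exists>l r. l \<in> ?K \<and> strict_mono r \<and> limitin mtopology (\<sigma> \<circ> r) l sequentially"
    if \<sigma>: "range \<sigma> \<subseteq> ?K" for \<sigma> :: "nat \<Rightarrow> _"
  proof -
    obtain l r where l: "l \<in> ?K" and r: "strict_mono (r :: nat \<Rightarrow> nat)" and lim: "(\<sigma> \<circ> r) \<longlonglongrightarrow> l"
      using seq_compactE[OF \<open>seq_compact ?K\<close>, of \<sigma>] \<sigma> by blast
    have K: "\<sigma> n \<in> ?K" for n using \<sigma> by blast
    have l1: "(\<lambda>n. l1_norm (fst ((\<sigma> \<circ> r) n) - fst l)) \<longlonglongrightarrow> 0"
    proof (rule l1_tendsto_dominated)
      show "(\<lambda>i. g i + g i) summable_on UNIV" by (intro summable_on_add g)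
      show "cmod (fst ((\<sigma> \<circ> r) n) i - fst l i) \<le> g i + g i" for n i
        using K[of "r n"] l by (intro order_trans[OF norm_triangle_ineq4] add_mono) auto
      show "(\<lambda>n. fst ((\<sigma> \<circ> r) n) i) \<longlonglongrightarrow> fst l i" for i
        by (rule continuous_on_tendsto_compose[OF continuous_on_product_coordinates[of i]
              tendsto_fst[OF lim]]) auto
    qed
    have snd: "(\<lambda>n. cmod (snd ((\<sigma> \<circ> r) n) - snd l)) \<longlonglongrightarrow> 0"
      using tendsto_dist_iff[THEN iffD1, OF tendsto_snd[OF lim]] by (simp add: dist_norm)
    have "(\<lambda>n. l1_inf_norm ((\<sigma> \<circ> r) n - l)) \<longlonglongrightarrow> 0"
      unfolding l1_inf_norm_def max_norm_def fst_diff snd_diff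
      using tendsto_max[OF l1 snd] by (simp only: max.idem)
    moreover have "(\<sigma> \<circ> r) n \<in> l1_inf" for n using K sub by auto
    ultimately have "limitin mtopology (\<sigma> \<circ> r) l sequentially"
      using limitin_norm_topology[OF complex_normed_space_l1_inf, of "\<sigma> \<circ> r" l] l sub
      by (auto simp: norm_topology_eq[OF complex_normed_space_l1_inf])
    then show ?thesis using l r by blast
  qed
  then show ?thesis
    unfolding norm_topology_eq[OF complex_normed_space_l1_inf] compactin_sequentially
    using sub by blast
qed

section \<open>Weighted shifts and their algebraic inverses\<close>

text \<open>A shift on the chain moves coordinates injectively except at the one index
  \<open>j\<close> that is fed from the summand of complex numbers: 1 for the shift, 0 for its
  inverse.\<close>

lemma l1_norm_reindex:
  assumes x: "x \<in> l1_space" and h: "inj_on h (- {j})"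
    and y: "\<And>i. i \<noteq> j \<Longrightarrow> cmod (y i) \<le> cmod (x (h i))"
  shows "y \<in> l1_space" and "l1_norm y \<le> cmod (y j) + l1_norm x"
proof -
  have "(\<Sum>i\<in>F. cmod (y i)) \<le> cmod (y j) + l1_norm x" if F: "finite F" for F
  proof -
    have "(\<Sum>i\<in>F. cmod (y i)) \<le> (\<Sum>i\<in>insert j (F - {j}). cmod (y i))"
      using F by (intro sum_mono2) auto
    also have "\<dots> = cmod (y j) + (\<Sum>i\<in>F - {j}. cmod (y i))" using F by (subst sum.insert) auto
    also have "(\<Sum>i\<in>F - {j}. cmod (y i)) \<le> (\<Sum>i\<in>F - {j}. cmod (x (h i)))"
      by (intro sum_mono y) auto
    also have "\<dots> = (\<Sum>i\<in>h ` (F - {j}). cmod (x i))"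
      using inj_on_subset[OF h, of "F - {j}"] by (subst sum.reindex) auto
    also have "\<dots> \<le> l1_norm x" using F by (intro sum_le_l1_norm[OF x]) auto
    finally show ?thesis by simp
  qed
  then show "y \<in> l1_space" and "l1_norm y \<le> cmod (y j) + l1_norm x" using l1I by blast+
qed

text \<open>
  A bilateral weighted shift along the chain \<open>\<dots> \<rightarrow> 4 \<rightarrow> 2 \<rightarrow> 0 \<rightarrow> * \<rightarrow> 1 \<rightarrow> 3 \<rightarrow> \<dots>\<close>, where \<open>*\<close> is
  the coordinate of the summand \<open>\<complex>\<close>.
\<close>

definition chain_shift :: "(nat \<Rightarrow> real) \<Rightarrow> (nat \<Rightarrow> complex) \<times> complex \<Rightarrow> (nat \<Rightarrow> complex) \<times> complex"
  where "chain_shift w p =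
    (\<lambda>i. of_real (w i) * (if even i then fst p (i + 2) else if i = 1 then snd p else fst p (i - 2)),
     4 * fst p 0)"

text \<open>The algebraic inverse of \<open>chain_shift\<close>, given on all sequences. For weights
  tending to 0 it is unbounded and leaves l1, so its domain as an operator is supplied separately as
  the range of the shift.\<close>

definition chain_unshift :: "(nat \<Rightarrow> real) \<Rightarrow> (nat \<Rightarrow> complex) \<times> complex \<Rightarrow> (nat \<Rightarrow> complex) \<times> complex"
  where "chain_unshift w p =
    (\<lambda>i. if i = 0 then snd p / 4
      else if even i then fst p (i - 2) / of_real (w (i - 2)) else fst p (i + 2) / of_real (w (i + 2)),
     fst p 1 / of_real (w 1))"

lemma nat_two_step_cases:
  obtains "i = 0" | "i = 1" | j where "i = Suc (Suc j)"
  by (metis One_nat_def not0_implies_Suc)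

lemma chain_unshift_shift:
  assumes "\<And>i. w i \<noteq> 0"
  shows "chain_unshift w (chain_shift w p) = p"
proof -
  have "fst (chain_unshift w (chain_shift w p)) i = fst p i" for i
    by (cases i rule: nat_two_step_cases) (use assms in \<open>simp_all add: chain_shift_def chain_unshift_def\<close>)
  then show ?thesis
    using assms by (simp add: chain_shift_def chain_unshift_def prod_eq_iff fun_eq_iff)
qed

lemma chain_shift_unshift:
  assumes "\<And>i. w i \<noteq> 0"
  shows "chain_shift w (chain_unshift w p) = p"
proof -
  have "fst (chain_shift w (chain_unshift w p)) i = fst p i" for i
    by (cases i rule: nat_two_step_cases) (use assms in \<open>simp_all add: chain_shift_def chain_unshift_def\<close>)
  then show ?thesis
    using assms by (simp add: chain_shift_def chain_unshift_def prod_eq_iff fun_eq_iff)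
qed

locale chain_weights =
  fixes w :: "nat \<Rightarrow> real"
  assumes weight_pos: "\<And>i. 0 < w i" and weight_le_1: "\<And>i. w i \<le> 1"
begin

abbreviation "R \<equiv> chain_shift w"
abbreviation "A \<equiv> chain_unshift w"

lemma A_R: "A (R p) = p" and R_A: "R (A p) = p"
  using weight_pos by (simp_all add: chain_unshift_shift chain_shift_unshift less_imp_neq[THEN not_sym])

lemma fst_R_bound: "cmod (fst (R p) i) \<le>
    w i * cmod (if even i then fst p (i + 2) else if i = 1 then snd p else fst p (i - 2))"
  using weight_pos[of i] by (simp add: chain_shift_def norm_mult less_imp_le)

lemma fst_R_bound': "cmod (fst (R p) i) \<le>
    cmod (if even i then fst p (i + 2) else if i = 1 then snd p else fst p (i - 2))"
  using fst_R_bound[of p i] weight_pos[of i] weight_le_1[of i]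
  by (elim order_trans) (simp add: mult_left_le_one_le less_imp_le)

lemma fst_R:
  assumes "fst p \<in> l1_space"
  shows "fst (R p) \<in> l1_space" and "l1_norm (fst (R p)) \<le> cmod (snd p) + l1_norm (fst p)"
proof -
  \<comment> \<open>The map names the coordinate from which coordinate i of \<open>R p\<close> is
    taken; coordinate 1 is excluded because it comes from \<open>snd p\<close>.\<close>
  have inj: "inj_on (\<lambda>i::nat. if even i then i + 2 else i - 2) (- {1})"
  proof (rule inj_onI)
    fix i k :: nat
    assume "i \<in> - {1}" "k \<in> - {1}"
      and "(if even i then i + 2 else i - 2) = (if even k then k + 2 else k - 2)"
    then show "i = k" by (cases "even i"; cases "even k"; simp; presburger)
  qed
  have "cmod (fst (R p) i) \<le> cmod (fst p (if even i then i + 2 else i - 2))" if "i \<noteq> 1" for i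
    using fst_R_bound'[of p i] that by (auto split: if_splits)
  note * = l1_norm_reindex[OF assms inj this]
  show "fst (R p) \<in> l1_space" by (rule *)
  show "l1_norm (fst (R p)) \<le> cmod (snd p) + l1_norm (fst p)"
    using *(2) fst_R_bound'[of p 1] by auto
qed

lemma linear_R: "linear_operator l1_inf l1_inf R"
  using l1_inf_normed(1) fst_R(1)
  by (auto simp: linear_operator_def l1_inf_iff chain_shift_def prod_eq_iff fun_eq_iff algebra_simps
      scaleC_prod_def scaleC_fun_def scaleC_complex_def)

lemma norm_R:
  assumes "p \<in> l1_inf"
  shows "l1_inf_norm (R p) \<le> 4 * l1_inf_norm p"
proof -
  have p: "fst p \<in> l1_space" using assms by (simp add: l1_inf_iff)
  have "cmod (snd (R p)) \<le> 4 * l1_norm (fst p)"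
    using cmod_le_l1_norm[OF p, of 0] by (simp add: chain_shift_def norm_mult)
  then show ?thesis
    using fst_R(2)[OF p] l1_norm_fst_le[of p] cmod_snd_le[of p] l1_norm_nonneg[of "fst p"]
    unfolding l1_inf_norm_le_iff by linarith
qed

lemma bounded_R: "bounded_operator l1_inf l1_inf_norm R"
  unfolding bounded_operator_def using linear_R norm_R by blast

section \<open>Evaluation of the resolvent norm\<close>

lemma in_resolvent_set:
  assumes "cmod \<mu> < 1 / 4"
  shows "\<mu> \<in> resolvent_set l1_inf l1_inf_norm (R ` l1_inf) A"
  by (rule resolvent_set_inverse[OF complex_banach_space_l1_inf linear_R norm_R A_R])
    (use assms in auto)

text \<open>Even indices precede 0 in the chain, so up to a weight at most 1 the coordinate of p at
  2k is that of x + \<mu> p at 2k + 2. Iterating this bound from 0 up to 2n leaves a remainder that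
  vanishes because p is in l1.\<close>

lemma resolvent_even_branch:
  assumes \<mu>: "cmod \<mu> < 1 / 4" and p: "fst p \<in> l1_space" and eq: "p = R (x + \<mu> *\<^sub>C p)"
  shows "(\<lambda>n. cmod (fst p (2 * n))) \<longlonglongrightarrow> 0"
    and "cmod (fst p 0) \<le> (\<Sum>k=1..n. cmod (fst x (2 * k))) + cmod (fst p (2 * n))"
proof -
  have "(\<lambda>i. cmod (fst p i)) \<longlonglongrightarrow> 0"
    using p unfolding l1_space_iff by (intro summable_LIMSEQ_zero summable_on_imp_summable)
  then show "(\<lambda>n. cmod (fst p (2 * n))) \<longlonglongrightarrow> 0"
    by (rule LIMSEQ_subseq_LIMSEQ[of _ _ "\<lambda>n. 2 * n", unfolded o_def]) (auto simp: strict_mono_def)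
  have step: "cmod (fst p (2 * k)) \<le> cmod (fst x (2 * Suc k)) + cmod (fst p (2 * Suc k))" for k
  proof -
    have "cmod (fst p (2 * k)) \<le> cmod (fst x (2 * Suc k) + \<mu> * fst p (2 * Suc k))"
      using fst_R_bound'[of "x + \<mu> *\<^sub>C p" "2 * k"] eq
      by (simp add: scaleC_prod_def scaleC_fun_def scaleC_complex_def)
    also have "\<dots> \<le> cmod (fst x (2 * Suc k)) + cmod \<mu> * cmod (fst p (2 * Suc k))"
      by (metis norm_mult norm_triangle_ineq)
    also have "cmod \<mu> * cmod (fst p (2 * Suc k)) \<le> cmod (fst p (2 * Suc k))"
      using \<mu> by (intro mult_left_le_one_le) auto
    finally show ?thesis by simp
  qed
  show "cmod (fst p 0) \<le> (\<Sum>k=1..n. cmod (fst x (2 * k))) + cmod (fst p (2 * n))"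
  proof (induction n)
    case (Suc n)
    then show ?case using step[of n] by (simp add: algebra_simps)
  qed simp
qed

lemma norm_resolvent_le:
  assumes \<mu>: "cmod \<mu> < 1 / 4" and p: "p \<in> l1_inf" and x: "x \<in> l1_inf" "l1_inf_norm x \<le> 1"
    and eq: "p = R (x + \<mu> *\<^sub>C p)"
  shows "l1_inf_norm p \<le> 4"
proof -
  have p': "fst p \<in> l1_space" and x': "fst x \<in> l1_space" using p x by (auto simp: l1_inf_iff)
  have nx: "l1_norm (fst x) \<le> 1" "cmod (snd x) \<le> 1" using x(2) by (auto simp: l1_inf_norm_le_iff)
  \<comment> \<open>Together with the entry at 0, the even branch collects distinct entries of x,
    whose moduli sum to at most 1.\<close>
  have "cmod (fst x 0) + cmod (fst p 0) \<le> 1 + cmod (fst p (2 * n))" for n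
  proof -
    have "cmod (fst x 0) + (\<Sum>k=1..n. cmod (fst x (2 * k))) = (\<Sum>k\<in>{0..n}. cmod (fst x (2 * k)))"
      by (simp add: sum.atLeast_Suc_atMost)
    also have "\<dots> = (\<Sum>i\<in>(*) 2 ` {0..n}. cmod (fst x i))"
      by (subst sum.reindex) (auto simp: inj_on_def)
    also have "\<dots> \<le> 1" using sum_le_l1_norm[OF x', of "(*) 2 ` {0..n}"] nx by simp
    finally show ?thesis using resolvent_even_branch(2)[OF \<mu> p' eq, of n] by simp
  qed
  moreover have "(\<lambda>n. 1 + cmod (fst p (2 * n))) \<longlonglongrightarrow> 1 + 0"
    by (intro tendsto_intros resolvent_even_branch(1)[OF \<mu> p' eq])
  ultimately have *: "cmod (fst x 0) + cmod (fst p 0) \<le> 1"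
    using LIMSEQ_le_const[of "\<lambda>n. 1 + cmod (fst p (2 * n))" "1 + 0"] by simp
  have "snd p = 4 * (fst x 0 + \<mu> * fst p 0)"
    using arg_cong[OF eq, of snd]
    by (simp add: chain_shift_def scaleC_prod_def scaleC_fun_def scaleC_complex_def)
  then have "cmod (snd p) = 4 * cmod (fst x 0 + \<mu> * fst p 0)" by (metis norm_mult norm_numeral)
  also have "cmod (fst x 0 + \<mu> * fst p 0) \<le> cmod (fst x 0) + cmod \<mu> * cmod (fst p 0)"
    by (metis norm_mult norm_triangle_ineq)
  also have "cmod \<mu> * cmod (fst p 0) \<le> cmod (fst p 0)"
    using \<mu> by (intro mult_left_le_one_le) auto
  finally have snd_p: "cmod (snd p) \<le> 4" using * by simp
  \<comment> \<open>With t = \<open>l1_norm (fst p)\<close> the bounds below add up to t <= 1 + 1 +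
    1 + t/4, so t <= 4. For a weight c > 1 and radius 1/c the same argument gives t <= 3 + t/c,
    which yields t <= c exactly when c >= 4.\<close>
  have \<mu>p: "cmod \<mu> * l1_norm (fst p) \<le> 1 / 4 * l1_norm (fst p)" "cmod \<mu> * cmod (snd p) \<le> 1 / 4 * 4"
    using \<mu> snd_p by (intro mult_mono; simp add: l1_norm_nonneg)+
  have xp: "x + \<mu> *\<^sub>C p \<in> l1_inf"
    using x p l1_inf_normed(1) by (intro cvec.subspace_add cvec.subspace_scale)
  have "l1_norm (fst p) \<le> cmod (snd (x + \<mu> *\<^sub>C p)) + l1_norm (fst (x + \<mu> *\<^sub>C p))"
    using fst_R(2)[of "x + \<mu> *\<^sub>C p"] xp eq by (simp add: l1_inf_iff)
  also have "cmod (snd (x + \<mu> *\<^sub>C p)) \<le> cmod (snd x) + cmod \<mu> * cmod (snd p)"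
    using norm_triangle_ineq[of "snd x" "\<mu> * snd p"]
    by (simp add: scaleC_prod_def scaleC_complex_def norm_mult)
  also have "l1_norm (fst (x + \<mu> *\<^sub>C p)) \<le> l1_norm (fst x) + cmod \<mu> * l1_norm (fst p)"
    using l1_normed(5)[OF x', of "\<mu> *\<^sub>C fst p"] p' cvec.subspace_scale[OF l1_normed(1)]
    by (simp add: scaleC_prod_def l1_normed(4))
  finally have "l1_norm (fst p) \<le> 4" using \<mu>p nx by linarith
  then show ?thesis using snd_p by (simp add: l1_inf_norm_le_iff)
qed

text \<open>The input is the basis vector at 0, with no mass on the rest of the even branch. Hence p
  vanishes at 0, and \<open>snd p\<close> is 4 for every \<mu>.\<close>

lemma norm_resolvent_attained:
  assumes \<mu>: "cmod \<mu> < 1 / 4" and p: "p \<in> l1_inf"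
    and eq: "p = R ((truncate 1 (\<lambda>_. 1), 0) + \<mu> *\<^sub>C p)"
  shows "4 \<le> l1_inf_norm p"
proof -
  have p': "fst p \<in> l1_space" using p by (auto simp: l1_inf_iff)
  have "cmod (fst p 0) \<le> cmod (fst p (2 * n))" for n
    using resolvent_even_branch(2)[OF \<mu> p' eq, of n] by (simp add: truncate_def)
  then have "cmod (fst p 0) \<le> 0"
    using LIMSEQ_le_const[OF resolvent_even_branch(1)[OF \<mu> p' eq]] by blast
  then have "snd p = 4"
    using arg_cong[OF eq, of snd]
    by (simp add: chain_shift_def scaleC_prod_def scaleC_fun_def scaleC_complex_def truncate_def)
  then show ?thesis using cmod_snd_le[of p] by simp
qed

lemma op_norm_resolvent:
  assumes \<mu>: "cmod \<mu> < 1 / 4"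
  shows "op_norm l1_inf l1_inf_norm (resolvent (R ` l1_inf) A \<mu>) = 4"
proof -
  let ?S = "resolvent (R ` l1_inf) A \<mu>"
  note S = resolvent_inverse_fixpoint[OF l1_inf_normed(1) linear_R A_R in_resolvent_set[OF \<mu>]]
  have le: "l1_inf_norm (?S x) \<le> 4" if "x \<in> l1_inf" "l1_inf_norm x \<le> 1" for x
    using norm_resolvent_le[OF \<mu> S(1) _ _ S(2)] that by blast
  let ?e = "(truncate 1 (\<lambda>_. 1), 0) :: (nat \<Rightarrow> complex) \<times> complex"
  have "l1_norm (truncate 1 (\<lambda>_. 1)) \<le> 1"
  proof (rule l1I(2))
    fix F :: "nat set" assume F: "finite F"
    have "(\<Sum>i\<in>F. cmod (truncate 1 (\<lambda>_. 1) i)) \<le> (\<Sum>i\<in>insert 0 F. if i = 0 then 1 else 0)"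
      using F by (intro order_trans[OF sum_mono sum_mono2]) (auto simp: truncate_def)
    then show "(\<Sum>i\<in>F. cmod (truncate 1 (\<lambda>_. 1) i)) \<le> 1" using F by simp
  qed
  then have e: "?e \<in> l1_inf" "l1_inf_norm ?e \<le> 1"
    by (auto simp: l1_inf_iff truncate_in_l1 l1_inf_norm_le_iff)
  have "4 \<le> l1_inf_norm (?S ?e)"
    by (rule norm_resolvent_attained[OF \<mu> S(1)[OF e(1)] S(2)[OF e(1)]])
  then have "4 = l1_inf_norm (?S ?e)" using le[OF e] by simp
  then have "4 \<in> (\<lambda>x. l1_inf_norm (?S x)) ` {x \<in> l1_inf. l1_inf_norm x \<le> 1}"
    by (rule image_eqI) (use e in blast)
  \<comment> \<open>The supremum is a maximum, so no separate proof of boundedness of the set is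
    required.\<close>
  then show ?thesis unfolding op_norm_def by (rule cSup_eq_maximum) (use le in blast)
qed

section \<open>Compactness and dense range\<close>

text \<open>Entries of a vector in the unit ball have modulus at most 1, so its image lies in the
  box with radii \<open>w i\<close> and 4, which is compact for summable weights.\<close>

lemma compact_R:
  assumes "w summable_on UNIV"
  shows "compact_operator l1_inf l1_inf_norm R"
proof -
  let ?X = "norm_topology l1_inf l1_inf_norm" and ?ball = "{x \<in> l1_inf. l1_inf_norm x \<le> 1}"
  let ?K = "{p. (\<forall>i. cmod (fst p i) \<le> w i) \<and> cmod (snd p) \<le> 4}"
  note K = compactin_l1_inf_box[OF assms, of 4]
  have "R x \<in> ?K" if x: "x \<in> ?ball" for x
  proof -
    have f: "cmod (fst x i) \<le> 1" for i
      using x cmod_le_l1_norm[of "fst x" i] by (auto simp: l1_inf_iff l1_inf_norm_le_iff)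
    have "cmod (fst (R x) i) \<le> w i * 1" for i
      using x f weight_pos[of i]
      by (intro order_trans[OF fst_R_bound] mult_left_mono) (auto simp: l1_inf_norm_le_iff)
    then show ?thesis using f[of 0] by (simp add: chain_shift_def norm_mult)
  qed
  then have "?X closure_of (R ` ?ball) \<subseteq> ?K"
    using compactin_imp_closedin[OF Hausdorff_space_norm_topology[OF complex_normed_space_l1_inf] K]
    by (intro closure_of_minimal) auto
  then have "compactin ?X (?X closure_of (R ` ?ball))"
    using K by (meson closed_compactin closedin_closure_of)
  then show ?thesis using linear_R by (simp add: compact_operator_def)
qed

text \<open>Vectors with finitely supported l1-component are dense. They lie in the range because
  \<open>A\<close> maps them to vectors of the same kind.\<close>

lemma densely_defined_range: "densely_defined l1_inf l1_inf_norm (R ` l1_inf)"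
proof -
  have sub: "R ` l1_inf \<subseteq> l1_inf" using linear_R by (simp add: linear_operator_def)
  have "\<exists>s\<in>R ` l1_inf. l1_inf_norm (s - x) < e" if x: "x \<in> l1_inf" and e: "e > 0" for x e
  proof -
    obtain n where n: "l1_norm (truncate n (fst x) - fst x) < e"
      using order_tendstoD(2)[OF truncate_tendsto[of "fst x"], of e] x e
      by (auto simp: eventually_sequentially l1_inf_iff)
    let ?s = "(truncate n (fst x), snd x)"
    \<comment> \<open>Along the even indices \<open>A\<close> moves entries up by 2, so the support
      may grow from below \<open>n\<close> to below n + 2.\<close>
    have "fst (A ?s) = truncate (n + 2) (fst (A ?s))"
      by (auto simp: chain_unshift_def truncate_def fun_eq_iff)
    then have "A ?s \<in> l1_inf" unfolding l1_inf_iff by (metis truncate_in_l1)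
    then have "?s \<in> R ` l1_inf" by (metis R_A imageI)
    moreover have "l1_inf_norm (?s - x) < e" using n e by (simp add: l1_inf_norm_def max_norm_def)
    ultimately show ?thesis by blast
  qed
  then show ?thesis
    using in_closure_of_norm_topology[OF complex_normed_space_l1_inf sub]
    by (auto simp: densely_defined_def)
qed

end

section \<open>Summable weights for the unbounded operator, unit weights for the bounded one\<close>

interpretation compact: chain_weights "\<lambda>i. (1 / 2) ^ i"
  by unfold_locales (auto intro: power_le_one)

interpretation unweighted: chain_weights "\<lambda>i. 1"
  by unfold_locales auto

lemma fst_unweighted_unshift:
  assumes "fst p \<in> l1_space"
  shows "fst (chain_unshift (\<lambda>i. 1) p) \<in> l1_space"
    and "l1_norm (fst (chain_unshift (\<lambda>i. 1) p)) \<le> cmod (snd p) + l1_norm (fst p)"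
proof -
  let ?y = "fst (chain_unshift (\<lambda>i. 1) p)"
  have inj: "inj_on (\<lambda>i::nat. if even i then i - 2 else i + 2) (- {0})"
  proof (rule inj_onI)
    fix i k :: nat
    assume "i \<in> - {0}" "k \<in> - {0}"
      and "(if even i then i - 2 else i + 2) = (if even k then k - 2 else k + 2)"
    then show "i = k" by (cases "even i"; cases "even k"; simp; presburger)
  qed
  have "cmod (?y i) \<le> cmod (fst p (if even i then i - 2 else i + 2))" if "i \<noteq> 0" for i
    using that by (simp add: chain_unshift_def)
  note * = l1_norm_reindex[OF assms inj this]
  show "?y \<in> l1_space" by (rule *)
  have "cmod (?y 0) \<le> cmod (snd p)" by (simp add: chain_unshift_def norm_divide)
  then show "l1_norm ?y \<le> cmod (snd p) + l1_norm (fst p)" using *(2) by linarith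
qed

text \<open>With unit weights the inverse is defined everywhere, so the results on the domain given
  by the range of the shift apply to \<open>B\<close> on the whole space.\<close>

lemma range_unweighted_shift: "chain_shift (\<lambda>i. 1) ` l1_inf = l1_inf"
proof
  show "chain_shift (\<lambda>i. 1) ` l1_inf \<subseteq> l1_inf"
    using unweighted.linear_R by (simp add: linear_operator_def)
  show "l1_inf \<subseteq> chain_shift (\<lambda>i. 1) ` l1_inf"
    using fst_unweighted_unshift(1) unweighted.R_A by (metis image_eqI l1_inf_iff subsetI)
qed

lemma bounded_unweighted_unshift:
  "bounded_operator l1_inf l1_inf_norm (chain_unshift (\<lambda>i. 1))"
proof -
  have "linear_operator l1_inf l1_inf (chain_unshift (\<lambda>i. 1))"
    using linear_operator_inverse[OF unweighted.linear_R unweighted.A_R]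
    by (simp add: range_unweighted_shift)
  moreover have "l1_inf_norm (chain_unshift (\<lambda>i. 1) p) \<le> 2 * l1_inf_norm p" if "p \<in> l1_inf" for p
  proof -
    have p: "fst p \<in> l1_space" using that by (simp add: l1_inf_iff)
    have "cmod (snd (chain_unshift (\<lambda>i. 1) p)) \<le> l1_norm (fst p)"
      using cmod_le_l1_norm[OF p, of 1] by (simp add: chain_unshift_def)
    then show ?thesis
      using fst_unweighted_unshift(2)[OF p] l1_norm_fst_le[of p] cmod_snd_le[of p] l1_norm_nonneg[of "fst p"]
      unfolding l1_inf_norm_le_iff by linarith
  qed
  ultimately show ?thesis unfolding bounded_operator_def by blast
qed

theorem theorem3p1:
  shows "\<exists>(Y :: (nat \<Rightarrow> complex) set) (N :: (nat \<Rightarrow> complex) \<Rightarrow> real).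
    complex_banach_space Y N \<and>
    separable_space (norm_topology Y N) \<and>
    complex_uniformly_convex Y N \<and>
    (\<exists>(B :: (nat \<Rightarrow> complex) \<times> complex \<Rightarrow> (nat \<Rightarrow> complex) \<times> complex)
      (D :: ((nat \<Rightarrow> complex) \<times> complex) set)
      (A :: (nat \<Rightarrow> complex) \<times> complex \<Rightarrow> (nat \<Rightarrow> complex) \<times> complex).
      let Z = Y \<times> (UNIV :: complex set); M = max_norm N cmod in
        bounded_operator Z M B \<and>
        closed_operator Z M D A \<and>
        densely_defined Z M D \<and>
        compact_resolvent Z M D A \<and>
        (\<exists>U. open U \<and> 0 \<in> U \<and>
          U \<subseteq> resolvent_set Z M D A \<and> U \<subseteq> resolvent_set Z M Z B \<and>
          (\<lambda>\<mu>. op_norm Z M (resolvent D A \<mu>)) constant_on U \<and>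
          (\<lambda>\<mu>. op_norm Z M (resolvent Z B \<mu>)) constant_on U))"
proof -
  let ?w = "\<lambda>i::nat. (1 / 2 :: real) ^ i"
  let ?D = "chain_shift ?w ` l1_inf" and ?A = "chain_unshift ?w" and ?B = "chain_unshift (\<lambda>i. 1)"
  let ?U = "ball 0 (1 / 4) :: complex set"
  have "?w summable_on UNIV" by (rule summable_nonneg_imp_summable_on) (auto intro: summable_geometric)
  note compact = compact.compact_R[OF this]
  have UA: "?U \<subseteq> resolvent_set l1_inf l1_inf_norm ?D ?A"
    using compact.in_resolvent_set by auto
  have UB: "?U \<subseteq> resolvent_set l1_inf l1_inf_norm l1_inf ?B"
    using unweighted.in_resolvent_set by (auto simp: range_unweighted_shift)
  have cA: "(\<lambda>\<mu>. op_norm l1_inf l1_inf_norm (resolvent ?D ?A \<mu>)) constant_on ?U"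
    using compact.op_norm_resolvent by (auto simp: constant_on_def)
  have cB: "(\<lambda>\<mu>. op_norm l1_inf l1_inf_norm (resolvent l1_inf ?B \<mu>)) constant_on ?U"
    using unweighted.op_norm_resolvent by (auto simp: constant_on_def range_unweighted_shift)
  have "resolvent_set l1_inf l1_inf_norm ?D ?A \<noteq> {}" using UA by force
  then have "compact_resolvent l1_inf l1_inf_norm ?D ?A"
    by (rule compact_resolvent_inverse[OF complex_normed_space_l1_inf compact compact.A_R])
  moreover have "closed_operator l1_inf l1_inf_norm ?D ?A"
    by (rule closed_operator_inverse[OF complex_normed_space_l1_inf compact.bounded_R compact.A_R])
  moreover have "open ?U" "0 \<in> ?U" by auto
  ultimately have "bounded_operator l1_inf l1_inf_norm ?B \<and>
      closed_operator l1_inf l1_inf_norm ?D ?A \<and>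
      densely_defined l1_inf l1_inf_norm ?D \<and>
      compact_resolvent l1_inf l1_inf_norm ?D ?A \<and>
      (\<exists>U. open U \<and> 0 \<in> U \<and>
        U \<subseteq> resolvent_set l1_inf l1_inf_norm ?D ?A \<and> U \<subseteq> resolvent_set l1_inf l1_inf_norm l1_inf ?B \<and>
        (\<lambda>\<mu>. op_norm l1_inf l1_inf_norm (resolvent ?D ?A \<mu>)) constant_on U \<and>
        (\<lambda>\<mu>. op_norm l1_inf l1_inf_norm (resolvent l1_inf ?B \<mu>)) constant_on U)"
    using bounded_unweighted_unshift compact.densely_defined_range UA UB cA cB by blast
  then show ?thesis
    unfolding l1_inf_def l1_inf_norm_def Let_def
    using complex_banach_space_l1 separable_space_l1 complex_uniformly_convex_l1 by blast
qed

end
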